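(* Let $K\ge1$, $\delta\in(0,1)$ and $\gamma\in[1,1/\delta)$. For each $i\in[K]$ let $(W_i^t)_{t\ge0}$ be a Brownian motion started at $0$ with drift $\theta_i\in\mathbb R$ and volatility $1$, the $W_i$ being independent. Let $\tau_i=\inf\{t\ge0: W_i^t\ge\gamma-1\text{ or }W_i^t\le-1\}$ and $S=\{i\in[K]: W_i^{\tau_i}=\gamma-1\}$. Let $\beta=K/(\delta|S|)$ and $\eta_i=\inf\{t\ge0: W_i^t\ge\beta-1\text{ or }W_i^t\le-1\}$. For $\theta\in\mathbb R$ define $Z_i^t(\theta)=1+W_i^t-\theta t$ and $X_i^t(\theta)=Z_i^t(\theta)\,\mathbf 1\{\inf_{s\in[0,t]}Z_i^s(\theta)>0\}$, and for $i\in S$ define the e-CI $$C_i(\alpha)=\left\{\theta\in\mathbb R: X_i^{\eta_i}(\theta)<\frac{1}{\alpha}\right\}=\left(\min\left(\frac{1+W_i^{\eta_i}-1/\alpha}{\eta_i},\ \inf_{s\in[0,\eta_i]}\frac{1+W_i^s}{s}\right),\infty\right).$$ The e-BY procedure reports $C_i(\delta|S|/K)$ for each $i\in S$, with false coverage rate $\mathrm{FCR}=\mathbb{E}\left[\sum_{i\in S}\mathbf 1\{\theta_i\notin C_i(\delta|S|/K)\}/(|S|\vee1)\right]$. Then, as $\boldsymbol\theta=(\theta_1,\dots,\theta_K)$ approaches $\mathbf 0$ from below (each $\theta_i<0$, $\theta_i\uparrow0$), $\lim\mathrm{FCR}=\delta$. *)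

theory Defs
  imports "HOL-Probability.Probability"
begin

text \<open>Independent Brownian motions (volatility 1) started at 0, indexed by the finite
type 'k (so [K] is UNIV :: 'k set, K = CARD('k)), with drifts mu i.
Characterised as usual: W i 0 = 0, continuous paths, and for every partition
0 = t_0 < t_1 < ... < t_n all increments W i t_(j+1) - W i t_j (over all i and j) are
mutually independent and Gaussian with mean mu i (t_(j+1) - t_j) and variance t_(j+1) - t_j.\<close>
definition indep_BMs_drift ::
  "'a measure \<Rightarrow> ('k::finite \<Rightarrow> real \<Rightarrow> 'a \<Rightarrow> real) \<Rightarrow> ('k \<Rightarrow> real) \<Rightarrow> bool" where
  "indep_BMs_drift M W mu \<longleftrightarrow>
     prob_space M \<and>
     (\<forall>i t. W i t \<in> borel_measurable M) \<and>
     (\<forall>i. \<forall>\<omega>\<in>space M. W i 0 \<omega> = 0 \<and> continuous_on {0..} (\<lambda>t. W i t \<omega>)) \<and>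
     (\<forall>(n::nat) (t::nat \<Rightarrow> real). t 0 = 0 \<and> (\<forall>j<n. t j < t (Suc j)) \<longrightarrow>
        prob_space.indep_vars M (\<lambda>_. borel)
          (\<lambda>(i, j) \<omega>. W i (t (Suc j)) \<omega> - W i (t j) \<omega>) (UNIV \<times> {..<n}) \<and>
        (\<forall>i. \<forall>j<n. distributed M lborel (\<lambda>\<omega>. W i (t (Suc j)) \<omega> - W i (t j) \<omega>)
            (\<lambda>x. ennreal (normal_density (mu i * (t (Suc j) - t j)) (sqrt (t (Suc j) - t j)) x))))"

definition exit_time :: "(real \<Rightarrow> real) \<Rightarrow> real \<Rightarrow> real" where
  "exit_time w a = Inf {t. 0 \<le> t \<and> (a \<le> w t \<or> w t \<le> -1)}"

definition Zproc :: "(real \<Rightarrow> real) \<Rightarrow> real \<Rightarrow> real \<Rightarrow> real" where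
  "Zproc w \<theta> t = 1 + w t - \<theta> * t"

definition Xproc :: "(real \<Rightarrow> real) \<Rightarrow> real \<Rightarrow> real \<Rightarrow> real" where
  "Xproc w \<theta> t = Zproc w \<theta> t * (if Inf ((\<lambda>s. Zproc w \<theta> s) ` {0..t}) > 0 then 1 else 0)"

definition eCI :: "(real \<Rightarrow> real) \<Rightarrow> real \<Rightarrow> real \<Rightarrow> real set" where
  "eCI w \<eta> \<alpha> = {\<theta>. Xproc w \<theta> \<eta> < 1 / \<alpha>}"

definition selected :: "('k::finite \<Rightarrow> real \<Rightarrow> real) \<Rightarrow> real \<Rightarrow> 'k set" where
  "selected w \<gamma> = {i. w i (exit_time (w i) (\<gamma> - 1)) = \<gamma> - 1}"

definition eBY_FCR ::
  "'a measure \<Rightarrow> ('k::finite \<Rightarrow> real \<Rightarrow> 'a \<Rightarrow> real) \<Rightarrow> ('k \<Rightarrow> real) \<Rightarrow> real \<Rightarrow> real \<Rightarrow> real" where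
  "eBY_FCR M W \<theta> \<delta> \<gamma> =
     (\<integral>\<omega>. (let w = (\<lambda>i t. W i t \<omega>);
               S = selected w \<gamma>;
               K = real CARD('k);
               \<beta> = K / (\<delta> * real (card S))
           in (\<Sum>i\<in>S. if \<theta> i \<notin> eCI (w i) (exit_time (w i) (\<beta> - 1)) (\<delta> * real (card S) / K)
                       then 1 else 0) / real (max (card S) 1)) \<partial>M)"

end

theory Submission
  imports Defs
begin

text \<open>
  Let \<open>\<beta>\<^sub>s = K / (\<delta> s)\<close>. For \<open>i\<close> selected with \<open>card S = s\<close>, the interval of \<open>i\<close> misses \<open>\<theta> i\<close>
  when \<open>W i\<close> reaches \<open>\<beta>\<^sub>s - 1\<close> before \<open>-1\<close>; the only other way is that leaving
  \<open>(-1, \<beta>\<^sub>s - 1)\<close> takes time at least \<open>\<beta>\<^sub>s / \<bar>\<theta> i\<bar>\<close>, which has vanishing probability since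
  \<open>W i T\<close> is Gaussian with density at most \<open>1 / sqrt T\<close>. As \<open>\<gamma> < \<beta>\<^sub>s\<close>, reaching \<open>\<beta>\<^sub>s - 1\<close> forces
  \<open>i \<in> S\<close> already, so no Markov property at the selection time is needed: given
  \<open>card (S - {i}) = s - 1\<close>, an event independent of \<open>W i\<close>, the contribution of \<open>i\<close> is
  \<open>P(W i reaches \<beta>\<^sub>s - 1) / s\<close>. Optional stopping at the exit time truncated at \<open>T = 1 / sqrt \<bar>\<theta> i\<bar>\<close>
  gives \<open>P(W i reaches \<beta>\<^sub>s - 1) \<rightarrow> 1 / \<beta>\<^sub>s = \<delta> s / K\<close>. Hence each \<open>i\<close> contributes \<open>\<delta> / K\<close> in the
  limit, whatever the law of \<open>S - {i}\<close>.
\<close>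

section \<open>Exit times of continuous paths\<close>

text \<open>Stated without the exit time, so that it is antimonotone in the level and meaningful for
  paths that never leave; \<open>hits_iff_exit_time\<close> gives the link.\<close>

definition hits :: "(real \<Rightarrow> real) \<Rightarrow> real \<Rightarrow> bool" where
  "hits w a \<longleftrightarrow> (\<exists>t\<ge>0. a \<le> w t \<and> (\<forall>s\<in>{0..t}. -1 < w s))"

text \<open>For negative \<open>t\<close> this is vacuous, so its negation says that the path leaves
  by time \<open>t\<close> and also forces \<open>0 \<le> t\<close>.\<close>

definition confined :: "(real \<Rightarrow> real) \<Rightarrow> real \<Rightarrow> real \<Rightarrow> bool" where
  "confined w a t \<longleftrightarrow> (\<forall>s\<in>{0..t}. -1 < w s \<and> w s < a)"

lemma hits_antimono: "hits w b \<Longrightarrow> a \<le> b \<Longrightarrow> hits w a"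
  unfolding hits_def by force

lemma confined_antimono: "confined w a t \<Longrightarrow> s \<le> t \<Longrightarrow> confined w a s"
  unfolding confined_def by force

lemma confined_mono_level: "confined w a t \<Longrightarrow> a \<le> b \<Longrightarrow> confined w b t"
  unfolding confined_def by force

text \<open>The exit set of a path that never leaves the interval is empty, so its exit time is the
  unspecified but fixed real \<open>Inf {}\<close>. This null event still has to be measurable.\<close>
lemma exit_time_const: "(\<And>t. 0 \<le> t \<Longrightarrow> confined w a t) \<Longrightarrow> exit_time w a = Inf {}"
proof -
  assume c: "\<And>t. 0 \<le> t \<Longrightarrow> confined w a t"
  have "-1 < w t \<and> w t < a" if "0 \<le> t" for t
    using c[OF that] that unfolding confined_def by auto
  then have "{t. 0 \<le> t \<and> (a \<le> w t \<or> w t \<le> -1)} = {}"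
    by (force simp: not_le)
  then show ?thesis unfolding exit_time_def by (simp only:)
qed

text \<open>By continuity the exit set is closed, so its infimum is attained; the bounds valid at
  earlier times then put the path exactly on the boundary.\<close>

lemma exit_time_props:
  assumes cont: "continuous_on {0..} w" and w0: "w 0 = 0" and a: "0 \<le> a"
    and ex: "\<not> confined w a T"
  defines "\<tau> \<equiv> exit_time w a"
  shows exit_time_nonneg: "0 \<le> \<tau>"
    and exit_time_le: "\<tau> \<le> T"
    and before_exit_time: "\<And>s. 0 \<le> s \<Longrightarrow> s < \<tau> \<Longrightarrow> -1 < w s \<and> w s < a"
    and at_exit_time: "w \<tau> = a \<or> w \<tau> = -1"
    and hits_iff_exit_time: "w \<tau> = a \<longleftrightarrow> hits w a"
proof -
  define E where "E = {t. 0 \<le> t \<and> (a \<le> w t \<or> w t \<le> -1)}"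
  have \<tau>: "\<tau> = Inf E" unfolding \<tau>_def exit_time_def E_def ..
  obtain t where t: "0 \<le> t" "t \<le> T" "t \<in> E"
    using ex unfolding confined_def E_def by force
  have bdd: "bdd_below E" unfolding E_def by (auto intro!: bdd_belowI[of _ 0])
  have "closed ({t\<in>{0..}. a \<le> w t} \<union> {t\<in>{0..}. w t \<le> -1})"
    using cont by (intro closed_Un continuous_on_closed_Collect_le continuous_intros) auto
  moreover have "E = {t\<in>{0..}. a \<le> w t} \<union> {t\<in>{0..}. w t \<le> -1}"
    unfolding E_def by auto
  ultimately have "closed E" by simp
  then have mem: "\<tau> \<in> E"
    unfolding \<tau> using t bdd by (intro closed_contains_Inf) auto
  then show nonneg: "0 \<le> \<tau>" unfolding E_def by auto
  show "\<tau> \<le> T" using cInf_lower[OF t(3) bdd] t unfolding \<tau> by auto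
  have lower: "\<tau> \<le> s" if "s \<in> E" for s
    unfolding \<tau> using cInf_lower[OF that bdd] .
  show before: "-1 < w s \<and> w s < a" if "0 \<le> s" "s < \<tau>" for s
    using lower[of s] that unfolding E_def by force
  \<comment> \<open>The left limit is available only for positive \<open>\<tau>\<close>. The case
    \<open>\<tau> = 0\<close> arises only for \<open>a = 0\<close>, the selection level for
    \<open>\<gamma> = 1\<close>, where every path is selected at once.\<close>
  have "w \<tau> \<le> a \<and> -1 \<le> w \<tau>" if "0 < \<tau>"
  proof -
    have "(w \<longlongrightarrow> w \<tau>) (at_left \<tau>)"
    proof (rule tendsto_within_subset)
      have "at \<tau> within {0..} = at \<tau>"
        using that by (intro at_within_interior) auto
      then show "(w \<longlongrightarrow> w \<tau>) (at \<tau>)"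
        using cont nonneg by (metis atLeast_iff continuous_on_def)
    qed simp
    moreover have "\<forall>\<^sub>F s in at_left \<tau>. w s \<le> a" "\<forall>\<^sub>F s in at_left \<tau>. -1 \<le> w s"
      using that before by (auto simp: eventually_at_left_field intro!: exI[of _ 0] less_imp_le)
    ultimately show ?thesis
      using tendsto_upperbound[of w "w \<tau>" "at_left \<tau>" a] tendsto_lowerbound[of w "w \<tau>" "at_left \<tau>" "-1"]
      by simp
  qed
  then show at: "w \<tau> = a \<or> w \<tau> = -1"
    using mem a w0 nonneg unfolding E_def by (cases "\<tau> = 0") auto
  show "w \<tau> = a \<longleftrightarrow> hits w a"
  proof
    assume "w \<tau> = a"
    then show "hits w a"
      unfolding hits_def using nonneg before a
      by (intro exI[of _ \<tau>]) (auto simp: order_le_less)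
  next
    assume "hits w a"
    then obtain t where t: "0 \<le> t" "a \<le> w t" "\<And>s. s\<in>{0..t} \<Longrightarrow> -1 < w s"
      unfolding hits_def by auto
    then have "\<tau> \<le> t" using lower[of t] by (auto simp: E_def)
    then have "-1 < w \<tau>" using t nonneg by auto
    then show "w \<tau> = a" using at by auto
  qed
qed

text \<open>For negative \<open>\<theta>\<close>, \<open>Zproc\<close> stays positive up to the exit
  time, so the killing in \<open>Xproc\<close> does nothing and the value is
  \<open>1 + w \<tau> - \<theta> * \<tau>\<close>. At the upper boundary this is at least
  \<open>b\<close>; at the lower one it is \<open>- \<theta> * \<tau>\<close>.\<close>

lemma eCI_miss_iff:
  assumes cont: "continuous_on {0..} w" and w0: "w 0 = 0" and b: "1 < b" and \<theta>: "\<theta> < 0"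
    and ex: "\<not> confined w (b - 1) T" and \<alpha>: "1 / \<alpha> = b"
  shows "\<theta> \<notin> eCI w (exit_time w (b - 1)) \<alpha> \<longleftrightarrow>
    hits w (b - 1) \<or> b \<le> - \<theta> * exit_time w (b - 1)"
proof -
  define \<tau> where "\<tau> = exit_time w (b - 1)"
  note p = exit_time_props[OF cont w0 _ ex, folded \<tau>_def]
  have \<tau>0: "0 \<le> \<tau>" using p(1) b by auto
  have pos: "0 < Zproc w \<theta> s" if "s \<in> {0..\<tau>}" for s
  proof (cases "s = 0")
    case False
    have "-1 \<le> w s" using p(3)[of s] p(4) b that by (cases "s = \<tau>") auto
    moreover have "0 < - \<theta> * s" using \<theta> False that by (auto intro: mult_neg_pos)
    ultimately show ?thesis unfolding Zproc_def by auto
  qed (simp add: Zproc_def w0)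
  have "continuous_on {0..\<tau>} (Zproc w \<theta>)"
    unfolding Zproc_def[abs_def] using cont
    by (intro continuous_intros) (auto elim: continuous_on_subset)
  \<comment> \<open>The infimum is attained, so pointwise positivity gives the strict positivity
    that \<open>Xproc\<close> tests.\<close>
  then obtain s where s: "s \<in> {0..\<tau>}" "\<And>r. r \<in> {0..\<tau>} \<Longrightarrow> Zproc w \<theta> s \<le> Zproc w \<theta> r"
    using continuous_attains_inf[of "{0..\<tau>}" "Zproc w \<theta>"] \<tau>0 by auto
  have "Inf (Zproc w \<theta> ` {0..\<tau>}) = Zproc w \<theta> s"
    using s by (intro cInf_eq_minimum) auto
  then have X: "Xproc w \<theta> \<tau> = 1 + w \<tau> - \<theta> * \<tau>"
    unfolding Xproc_def using pos[OF s(1)] by (simp add: Zproc_def)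
  have "\<theta> * \<tau> \<le> 0" using \<theta> \<tau>0 by (simp add: mult_nonpos_nonneg)
  then show ?thesis
    unfolding \<tau>_def[symmetric] eCI_def using X p(4,5) b \<alpha> by auto
qed

section \<open>Measurability of path events\<close>

lemma continuous_on_atLeast_Icc:
  "continuous_on {a..} f \<Longrightarrow> continuous_on {a..b} f" for f :: "_::{topological_space,preorder} \<Rightarrow> _"
  by (erule continuous_on_subset) auto

text \<open>By continuity the infimum equals that over a countable dense set of times. Measurability
  is assumed only on \<open>{0..u}\<close>, so the result applies to the sigma-algebra of the past
  up to \<open>u\<close>.\<close>

lemma measurable_cINF_continuous:
  fixes f :: "real \<Rightarrow> 'a \<Rightarrow> real"
  assumes meas: "\<And>s. s \<in> {0..u} \<Longrightarrow> f s \<in> borel_measurable N"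
    and cont: "\<And>\<omega>. \<omega> \<in> space N \<Longrightarrow> continuous_on {0..u} (\<lambda>s. f s \<omega>)"
  shows "(\<lambda>\<omega>. INF s\<in>{0..u}. f s \<omega>) \<in> borel_measurable N"
proof (cases "0 \<le> u")
  case True
  obtain D where D: "countable D" "D \<subseteq> {0..u}" "{0..u} \<subseteq> closure D"
    using separable by blast
  have cl: "closure D = {0..u}"
    using D closure_minimal[of D "{0..u}"] by auto
  have ne: "D \<noteq> {}" using cl True by auto
  have eq: "(INF s\<in>{0..u}. f s \<omega>) = (INF s\<in>D. f s \<omega>)" if \<omega>: "\<omega> \<in> space N" for \<omega>
  proof (rule antisym)
    have bdd: "bdd_below ((\<lambda>s. f s \<omega>) ` {0..u})"
      using compact_imp_bounded[OF compact_continuous_image[OF cont[OF \<omega>] compact_Icc]]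
      by (rule bounded_imp_bdd_below)
    show "(INF s\<in>{0..u}. f s \<omega>) \<le> (INF s\<in>D. f s \<omega>)"
      using bdd D(2) ne by (intro cINF_superset_mono) auto
    have bddD: "bdd_below ((\<lambda>s. f s \<omega>) ` D)"
      using bdd D(2) by (meson bdd_below_mono image_mono)
    have "(INF s\<in>D. f s \<omega>) \<le> f s \<omega>" if "s \<in> {0..u}" for s
      by (rule continuous_ge_on_closure[of D "\<lambda>s. f s \<omega>" s])
        (use cont[OF \<omega>] that cl cINF_lower[OF bddD] in auto)
    then show "(INF s\<in>D. f s \<omega>) \<le> (INF s\<in>{0..u}. f s \<omega>)"
      using True by (intro cINF_greatest) auto
  qed
  have "(\<lambda>\<omega>. INF s\<in>D. f s \<omega>) \<in> borel_measurable N"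
    using D meas by (intro borel_measurable_cINF_real) auto
  then show ?thesis using eq by (subst measurable_cong) auto
qed simp

text \<open>The infimum over a compact interval is attained, so the strict inequality at all times
  is a single strict inequality for the infimum.\<close>

lemma sets_All_greater_continuous:
  fixes f :: "real \<Rightarrow> 'a \<Rightarrow> real"
  assumes meas: "\<And>s. s \<in> {0..u} \<Longrightarrow> f s \<in> borel_measurable N"
    and cont: "\<And>\<omega>. \<omega> \<in> space N \<Longrightarrow> continuous_on {0..u} (\<lambda>s. f s \<omega>)"
  shows "{\<omega>\<in>space N. \<forall>s\<in>{0..u}. c < f s \<omega>} \<in> sets N"
proof (cases "0 \<le> u")
  case True
  have "(\<forall>s\<in>{0..u}. c < f s \<omega>) \<longleftrightarrow> c < (INF s\<in>{0..u}. f s \<omega>)" if \<omega>: "\<omega> \<in> space N" for \<omega>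
  proof -
    obtain s where s: "s \<in> {0..u}" "\<And>r. r \<in> {0..u} \<Longrightarrow> f s \<omega> \<le> f r \<omega>"
      using continuous_attains_inf[of "{0..u}" "\<lambda>s. f s \<omega>"] cont[OF \<omega>] True by auto
    have "(INF s\<in>{0..u}. f s \<omega>) = f s \<omega>"
      using s by (intro cInf_eq_minimum) auto
    then show ?thesis using s by (auto intro: less_le_trans)
  qed
  then have "{\<omega>\<in>space N. \<forall>s\<in>{0..u}. c < f s \<omega>} = {\<omega>\<in>space N. c < (INF s\<in>{0..u}. f s \<omega>)}"
    by auto
  then show ?thesis using measurable_cINF_continuous[OF meas cont]
    by (simp add: borel_measurable_iff_greater)
qed simp

lemma sets_confined:
  assumes meas: "\<And>s. s \<in> {0..u} \<Longrightarrow> X s \<in> borel_measurable N"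
    and cont: "\<And>\<omega>. \<omega> \<in> space N \<Longrightarrow> continuous_on {0..u} (\<lambda>s. X s \<omega>)"
  shows "{\<omega>\<in>space N. confined (\<lambda>s. X s \<omega>) a u} \<in> sets N"
proof -
  have "{\<omega>\<in>space N. confined (\<lambda>s. X s \<omega>) a u} =
      {\<omega>\<in>space N. \<forall>s\<in>{0..u}. -1 < X s \<omega>} \<inter> {\<omega>\<in>space N. \<forall>s\<in>{0..u}. -a < - X s \<omega>}"
    unfolding confined_def by auto
  also have "\<dots> \<in> sets N"
    using assms by (intro sets.Int sets_All_greater_continuous continuous_intros borel_measurable_uminus) auto
  finally show ?thesis .
qed

text \<open>Staying above \<open>-1\<close> persists slightly past the time of the hit, so a
  rational time beyond it can serve as witness and the event becomes a countable union. The sign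
  change fits \<open>sets_All_greater_continuous\<close>.\<close>

lemma hits_iff_rational:
  assumes cont: "continuous_on {0..} w"
  shows "hits w a \<longleftrightarrow> (\<exists>q\<in>\<rat>. (\<forall>s\<in>{0..q}. -1 < w s) \<and> \<not> (\<forall>s\<in>{0..q}. - a < - w s))"
proof
  assume "hits w a"
  then obtain t where t: "0 \<le> t" "a \<le> w t" "\<And>s. s \<in> {0..t} \<Longrightarrow> -1 < w s"
    unfolding hits_def by auto
  have "\<exists>d>0. \<forall>s\<in>{0..}. dist s t < d \<longrightarrow> dist (w s) (w t) < w t + 1"
    using cont t(1) t(3)[of t] unfolding continuous_on_iff by force
  then obtain d where d: "0 < d" "\<And>s. 0 \<le> s \<Longrightarrow> dist s t < d \<Longrightarrow> dist (w s) (w t) < w t + 1"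
    by auto
  obtain q where q: "q \<in> \<rat>" "t < q" "q < t + d"
    using Rats_dense_in_real[of t "t + d"] d(1) by auto
  have "-1 < w s" if "s \<in> {0..q}" for s
    using t(3)[of s] d(2)[of s] that q by (cases "s \<le> t") (auto simp: dist_real_def)
  moreover have "t \<in> {0..q}" using t q by auto
  ultimately show "\<exists>q\<in>\<rat>. (\<forall>s\<in>{0..q}. -1 < w s) \<and> \<not> (\<forall>s\<in>{0..q}. - a < - w s)"
    using q(1) t(2) by (intro bexI[of _ q] conjI) (auto intro!: bexI[of _ t])
qed (force simp: hits_def)

lemma sets_hits:
  assumes meas: "\<And>s. 0 \<le> s \<Longrightarrow> X s \<in> borel_measurable N"
    and cont: "\<And>\<omega>. \<omega> \<in> space N \<Longrightarrow> continuous_on {0..} (\<lambda>s. X s \<omega>)"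
  shows "{\<omega>\<in>space N. hits (\<lambda>s. X s \<omega>) a} \<in> sets N"
proof -
  have "{\<omega>\<in>space N. hits (\<lambda>s. X s \<omega>) a} = (\<Union>q\<in>\<rat>.
      {\<omega>\<in>space N. \<forall>s\<in>{0..q}. -1 < X s \<omega>} - {\<omega>\<in>space N. \<forall>s\<in>{0..q}. -a < - X s \<omega>})"
    using hits_iff_rational[OF cont] by auto
  also have "\<dots> \<in> sets N"
    using assms
    by (intro sets.countable_UN'' sets.Diff sets_All_greater_continuous continuous_on_minus
        borel_measurable_uminus) (auto simp: countable_rat intro: continuous_on_atLeast_Icc)
  finally show ?thesis .
qed

text \<open>Integer times keep the event a countable union; as \<open>confined\<close> is
  antimonotone in time, they detect every exit.\<close>

definition exits :: "(real \<Rightarrow> real) \<Rightarrow> real \<Rightarrow> bool" where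
  "exits w a \<longleftrightarrow> (\<exists>n::nat. \<not> confined w a (real n))"

lemma not_exitsD: "\<not> exits w a \<Longrightarrow> confined w a t"
  unfolding exits_def using confined_antimono real_arch_simple by meson

section \<open>Measurability of exit times, selection and coverage for a continuous process\<close>

context
  fixes X :: "real \<Rightarrow> 'a \<Rightarrow> real" and N :: "'a measure"
  assumes meas [measurable]: "\<And>s. X s \<in> borel_measurable N"
    and cont: "\<And>\<omega>. \<omega> \<in> space N \<Longrightarrow> continuous_on {0..} (\<lambda>s. X s \<omega>)"
    and zero: "\<And>\<omega>. \<omega> \<in> space N \<Longrightarrow> X 0 \<omega> = 0"
begin

lemma pred_confined: "Measurable.pred N (\<lambda>\<omega>. confined (\<lambda>s. X s \<omega>) a u)"
  unfolding pred_def using cont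
  by (intro sets_confined meas) (auto intro: continuous_on_atLeast_Icc)

lemma pred_hits: "Measurable.pred N (\<lambda>\<omega>. hits (\<lambda>s. X s \<omega>) a)"
  unfolding pred_def by (intro sets_hits meas cont)

lemma pred_exits: "Measurable.pred N (\<lambda>\<omega>. exits (\<lambda>s. X s \<omega>) a)"
  unfolding exits_def using pred_confined[measurable] by measurable

text \<open>Superlevel sets of the exit time become events about \<open>confined\<close>, since at
  the exit time the path is already on the boundary. Paths that never leave carry the constant
  \<open>Inf {}\<close>.\<close>

lemma exit_time_greater_iff:
  assumes \<omega>: "\<omega> \<in> space N" and a: "0 \<le> a"
  shows "t < exit_time (\<lambda>s. X s \<omega>) a \<longleftrightarrow>
    (exits (\<lambda>s. X s \<omega>) a \<and> (t < 0 \<or> confined (\<lambda>s. X s \<omega>) a t)) \<or>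
    (\<not> exits (\<lambda>s. X s \<omega>) a \<and> t < Inf {})"
proof (cases "exits (\<lambda>s. X s \<omega>) a")
  case True
  then obtain T where T: "\<not> confined (\<lambda>s. X s \<omega>) a T" unfolding exits_def by auto
  note p = exit_time_props[OF cont[OF \<omega>] zero[OF \<omega>] a T]
  have "t < exit_time (\<lambda>s. X s \<omega>) a \<longleftrightarrow> t < 0 \<or> confined (\<lambda>s. X s \<omega>) a t"
  proof
    assume t: "t < exit_time (\<lambda>s. X s \<omega>) a"
    then show "t < 0 \<or> confined (\<lambda>s. X s \<omega>) a t"
      unfolding confined_def using p(3) by auto
  next
    assume "t < 0 \<or> confined (\<lambda>s. X s \<omega>) a t"
    then show "t < exit_time (\<lambda>s. X s \<omega>) a"
    proof
      assume "confined (\<lambda>s. X s \<omega>) a t"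
      then show ?thesis using p(1,4) unfolding confined_def by (metis atLeastAtMost_iff less_irrefl not_le)
    qed (use p(1) in simp)
  qed
  then show ?thesis using True by simp
next
  case False
  then show ?thesis using exit_time_const[OF not_exitsD[OF False]] by simp
qed

lemma measurable_exit_time:
  "0 \<le> a \<Longrightarrow> (\<lambda>\<omega>. exit_time (\<lambda>s. X s \<omega>) a) \<in> borel_measurable N"
  unfolding borel_measurable_iff_greater
  using pred_confined[measurable] pred_exits[measurable]
  by (simp add: exit_time_greater_iff cong: conj_cong) measurable

text \<open>Evaluation at a random time is avoided: on leaving paths the condition is
  \<open>hits\<close>, and on the others the time is the constant \<open>Inf {}\<close>.\<close>

lemma pred_selected:
  assumes a: "0 \<le> a"
  shows "Measurable.pred N (\<lambda>\<omega>. X (exit_time (\<lambda>s. X s \<omega>) a) \<omega> = a)"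
proof -
  note pred_exits[measurable] pred_hits[measurable]
  have "Measurable.pred N (\<lambda>\<omega>. (exits (\<lambda>s. X s \<omega>) a \<and> hits (\<lambda>s. X s \<omega>) a) \<or>
      (\<not> exits (\<lambda>s. X s \<omega>) a \<and> X (Inf {}) \<omega> = a))"
    by measurable
  then show ?thesis
  proof (rule measurable_cong[THEN iffD1, rotated])
    fix \<omega> assume \<omega>: "\<omega> \<in> space N"
    show "(exits (\<lambda>s. X s \<omega>) a \<and> hits (\<lambda>s. X s \<omega>) a \<or>
      \<not> exits (\<lambda>s. X s \<omega>) a \<and> X (Inf {}) \<omega> = a) = (X (exit_time (\<lambda>s. X s \<omega>) a) \<omega> = a)"
    proof (cases "exits (\<lambda>s. X s \<omega>) a")
      case True
      then show ?thesis
        using exit_time_props(5)[OF cont[OF \<omega>] zero[OF \<omega>] a] unfolding exits_def by auto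
    next
      case False
      then show ?thesis using exit_time_const[OF not_exitsD[OF False]] by simp
    qed
  qed
qed

lemma measurable_Xproc: "(\<lambda>\<omega>. Xproc (\<lambda>s. X s \<omega>) \<theta> t) \<in> borel_measurable N"
proof -
  have [measurable]: "(\<lambda>\<omega>. INF s\<in>{0..t}. Zproc (\<lambda>s. X s \<omega>) \<theta> s) \<in> borel_measurable N"
    unfolding Zproc_def using cont
    by (intro measurable_cINF_continuous continuous_intros) (auto intro: continuous_on_atLeast_Icc)
  have [measurable]: "(\<lambda>\<omega>. Zproc (\<lambda>s. X s \<omega>) \<theta> t) \<in> borel_measurable N"
    unfolding Zproc_def by measurable
  show ?thesis unfolding Xproc_def by measurable
qed

text \<open>The same split as for selection: on leaving paths \<open>eCI_miss_iff\<close> removes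
  the evaluation of \<open>Xproc\<close> at a random time, and the other paths use a constant
  time.\<close>

lemma pred_eCI_miss:
  assumes b: "1 < b" and \<theta>: "\<theta> < 0" and \<alpha>: "1 / \<alpha> = b"
  shows "Measurable.pred N (\<lambda>\<omega>. \<theta> \<notin> eCI (\<lambda>s. X s \<omega>) (exit_time (\<lambda>s. X s \<omega>) (b - 1)) \<alpha>)"
proof -
  note pred_exits[measurable] pred_hits[measurable] measurable_Xproc[measurable]
  have [measurable]: "(\<lambda>\<omega>. exit_time (\<lambda>s. X s \<omega>) (b - 1)) \<in> borel_measurable N"
    using b by (intro measurable_exit_time) auto
  have "Measurable.pred N (\<lambda>\<omega>. (exits (\<lambda>s. X s \<omega>) (b - 1) \<and>
        (hits (\<lambda>s. X s \<omega>) (b - 1) \<or> b \<le> - \<theta> * exit_time (\<lambda>s. X s \<omega>) (b - 1))) \<or>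
      (\<not> exits (\<lambda>s. X s \<omega>) (b - 1) \<and> \<not> Xproc (\<lambda>s. X s \<omega>) \<theta> (Inf {}) < b))"
    by measurable
  then show ?thesis
  proof (rule measurable_cong[THEN iffD1, rotated])
    fix \<omega> assume \<omega>: "\<omega> \<in> space N"
    show "((exits (\<lambda>s. X s \<omega>) (b - 1) \<and>
        (hits (\<lambda>s. X s \<omega>) (b - 1) \<or> b \<le> - \<theta> * exit_time (\<lambda>s. X s \<omega>) (b - 1))) \<or>
      (\<not> exits (\<lambda>s. X s \<omega>) (b - 1) \<and> \<not> Xproc (\<lambda>s. X s \<omega>) \<theta> (Inf {}) < b)) =
      (\<theta> \<notin> eCI (\<lambda>s. X s \<omega>) (exit_time (\<lambda>s. X s \<omega>) (b - 1)) \<alpha>)"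
    proof (cases "exits (\<lambda>s. X s \<omega>) (b - 1)")
      case True
      then show ?thesis
        using eCI_miss_iff[OF cont[OF \<omega>] zero[OF \<omega>] b \<theta> _ \<alpha>] unfolding exits_def by auto
    next
      case False
      then show ?thesis using exit_time_const[OF not_exitsD[OF False]]
        by (simp add: eCI_def \<alpha>)
    qed
  qed
qed

end

section \<open>Independence of paths and increments\<close>

text \<open>Laws and independence of increments are given only along strictly increasing partitions
  from \<open>0\<close>, so an arbitrary finite set of times has to be embedded in one. Ending
  exactly at \<open>u\<close> allows a later point to be appended.\<close>

lemma finite_subset_partition:
  fixes G :: "real set"
  assumes "finite G" "G \<subseteq> {0..u}" "0 \<le> u"
  obtains t :: "nat \<Rightarrow> real" and m where
    "t 0 = 0" "\<And>j. j < m \<Longrightarrow> t j < t (Suc j)" "t m = u" "G \<subseteq> t ` {..m}"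
proof -
  have "\<exists>t m. t (0::nat) = 0 \<and> (\<forall>j<m. t j < t (Suc j)) \<and> t m = u \<and> G \<subseteq> t ` {..m}"
    using assms
  proof (induction G arbitrary: u rule: finite_linorder_max_induct)
    case empty
    show ?case
    proof (cases "u = 0")
      case True
      then show ?thesis by (intro exI[of _ "\<lambda>_. 0"] exI[of _ 0]) auto
    next
      case False
      then show ?thesis using empty by (intro exI[of _ "\<lambda>j. if j = 0 then 0 else u"] exI[of _ 1]) auto
    qed
  next
    case (insert b A)
    have "A \<subseteq> {0..b}" using insert by force
    then obtain t m where t: "t (0::nat) = 0" "\<And>j. j < m \<Longrightarrow> t j < t (Suc j)" "t m = b" "A \<subseteq> t ` {..m}"
      using insert.IH[of b] insert.prems by auto
    show ?case
    proof (cases "b = u")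
      case True
      then show ?thesis using t by (intro exI[of _ t] exI[of _ m]) auto
    next
      case False
      define t' where "t' j = (if j \<le> m then t j else u)" for j
      have "b < u" using False insert.prems by auto
      have "t' j < t' (Suc j)" if "j < Suc m" for j
        using t \<open>b < u\<close> that by (cases "j = m") (auto simp: t'_def)
      moreover have "insert b A \<subseteq> t' ` {..Suc m}"
        using t by (force simp: t'_def)
      moreover have "t' 0 = 0" "t' (Suc m) = u"
        using t by (auto simp: t'_def)
      ultimately show ?thesis by (intro exI[of _ t'] exI[of _ "Suc m"]) auto
    qed
  qed
  then show ?thesis using that by blast
qed

section \<open>Brownian paths and the sigma-algebras they generate\<close>

locale drifted_BMs =
  fixes M :: "'a measure" and W :: "'k::finite \<Rightarrow> real \<Rightarrow> 'a \<Rightarrow> real" and mu :: "'k \<Rightarrow> real"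
  assumes BMs: "indep_BMs_drift M W mu"

sublocale drifted_BMs \<subseteq> prob_space M
  using BMs by (simp add: indep_BMs_drift_def)

context drifted_BMs
begin

lemma measurable_W [measurable]: "W i t \<in> borel_measurable M"
  using BMs by (simp add: indep_BMs_drift_def)

lemma W_zero: "\<omega> \<in> space M \<Longrightarrow> W i 0 \<omega> = 0"
  using BMs by (simp add: indep_BMs_drift_def)

lemma W_cont: "\<omega> \<in> space M \<Longrightarrow> continuous_on {0..} (\<lambda>t. W i t \<omega>)"
  using BMs by (simp add: indep_BMs_drift_def)

lemma indep_increments:
  assumes "t 0 = 0" "\<And>j. j < n \<Longrightarrow> t j < t (Suc j)"
  shows "indep_vars (\<lambda>_. borel) (\<lambda>(i, j) \<omega>. W i (t (Suc j)) \<omega> - W i (t j) \<omega>) (UNIV \<times> {..<n})"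
  using BMs assms unfolding indep_BMs_drift_def by blast

lemma distributed_partition_increment:
  assumes "t 0 = 0" "\<And>j. j < n \<Longrightarrow> t j < t (Suc j)" "j < n"
  shows "distributed M lborel (\<lambda>\<omega>. W i (t (Suc j)) \<omega> - W i (t j) \<omega>)
    (normal_density (mu i * (t (Suc j) - t j)) (sqrt (t (Suc j) - t j)))"
  using BMs assms unfolding indep_BMs_drift_def by blast

text \<open>A partition of \<open>{0..u}\<close> is extended by \<open>v\<close>, which makes this
  the last increment of a partition starting at \<open>0\<close>.\<close>

lemma distributed_increment:
  assumes "0 \<le> u" "u < v"
  shows "distributed M lborel (\<lambda>\<omega>. W i v \<omega> - W i u \<omega>)
    (normal_density (mu i * (v - u)) (sqrt (v - u)))"
proof -
  obtain t m where t: "t (0::nat) = 0" "\<And>j. j < m \<Longrightarrow> t j < t (Suc j)" "t m = u"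
    using finite_subset_partition[of "{}" u] assms by auto
  define t' where "t' j = (if j \<le> m then t j else v)" for j
  have "t' j < t' (Suc j)" if "j < Suc m" for j
    using t assms that by (cases "j = m") (auto simp: t'_def)
  moreover have "t' 0 = 0" using t by (simp add: t'_def)
  ultimately show ?thesis
    using distributed_partition_increment[of t' "Suc m" m i] t by (simp add: t'_def)
qed

text \<open>A generating pi-system: \<open>I = {0..u}\<close> gives the past and
  \<open>I = {0..}\<close> the whole path.\<close>

definition cylinders :: "'k \<Rightarrow> real set \<Rightarrow> 'a set set" where
  "cylinders i I = {{\<omega>\<in>space M. \<forall>s\<in>G. W i s \<omega> \<in> A s} | G A.
     finite G \<and> G \<subseteq> I \<and> (\<forall>s. A s \<in> sets borel)}"

lemma cylindersE:
  assumes "C \<in> cylinders i I"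
  obtains G A where "C = {\<omega>\<in>space M. \<forall>s\<in>G. W i s \<omega> \<in> A s}" "finite G" "G \<subseteq> I" "\<And>s. A s \<in> sets borel"
  using assms unfolding cylinders_def by blast

lemma cylinders_events: "cylinders i I \<subseteq> events"
proof
  fix C assume "C \<in> cylinders i I"
  then show "C \<in> events"
  proof (rule cylindersE)
    fix G A assume C: "C = {\<omega>\<in>space M. \<forall>s\<in>G. W i s \<omega> \<in> A s}" "finite G"
      and [measurable]: "\<And>s. A s \<in> sets borel"
    show ?thesis unfolding C(1) using C(2)
      by (intro sets.sets_Collect_finite_All) measurable
  qed
qed

lemma cylinders_Pow: "cylinders i I \<subseteq> Pow (space M)"
  using cylinders_events sets.sets_into_space by blast

lemma Int_stable_cylinders: "Int_stable (cylinders i I)"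
proof (rule Int_stableI)
  fix C D assume "C \<in> cylinders i I" "D \<in> cylinders i I"
  then obtain G A H B where C: "C = {\<omega>\<in>space M. \<forall>s\<in>G. W i s \<omega> \<in> A s}" "finite G" "G \<subseteq> I" "\<And>s. A s \<in> sets borel"
    and D: "D = {\<omega>\<in>space M. \<forall>s\<in>H. W i s \<omega> \<in> B s}" "finite H" "H \<subseteq> I" "\<And>s. B s \<in> sets borel"
    unfolding cylinders_def by blast
  have "C \<inter> D = {\<omega>\<in>space M. \<forall>s\<in>G \<union> H. W i s \<omega> \<in>
      (if s \<in> G then A s else UNIV) \<inter> (if s \<in> H then B s else UNIV)}"
    unfolding C(1) D(1) by auto
  moreover have "(if s \<in> G then A s else UNIV) \<inter> (if s \<in> H then B s else UNIV) \<in> sets borel" for s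
    using C(4) D(4) by auto
  ultimately show "C \<inter> D \<in> cylinders i I"
    unfolding cylinders_def mem_Collect_eq using C(2,3) D(2,3)
    by (intro exI[of _ "G \<union> H"] exI[of _ "\<lambda>s. (if s \<in> G then A s else UNIV) \<inter> (if s \<in> H then B s else UNIV)"]) auto
qed

definition path_algebra :: "'k \<Rightarrow> real set \<Rightarrow> 'a measure" where
  "path_algebra i I = sigma (space M) (cylinders i I)"

lemma space_path_algebra [simp]: "space (path_algebra i I) = space M"
  unfolding path_algebra_def by (rule space_measure_of[OF cylinders_Pow])

lemma sets_path_algebra: "sets (path_algebra i I) = sigma_sets (space M) (cylinders i I)"
  unfolding path_algebra_def by (rule sets_measure_of[OF cylinders_Pow])

lemma measurable_W_path_algebra:
  assumes "s \<in> I"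
  shows "W i s \<in> borel_measurable (path_algebra i I)"
proof (rule measurableI)
  fix A :: "real set" assume "A \<in> sets borel"
  then have "W i s -` A \<inter> space M \<in> cylinders i I"
    unfolding cylinders_def mem_Collect_eq using assms
    by (intro exI[of _ "{s}"] exI[of _ "\<lambda>_. A"]) auto
  then show "W i s -` A \<inter> space (path_algebra i I) \<in> sets (path_algebra i I)"
    unfolding sets_path_algebra by (auto intro: sigma_sets.Basic)
qed simp

text \<open>As the path starts at \<open>0\<close>, its value at a partition point is the sum of the
  preceding increments. A cylinder is thus a preimage under the block of increments of coordinate
  \<open>i\<close>, the form in which independence is available.\<close>

lemma cylinder_as_increments:
  assumes t: "t 0 = 0" and G: "finite G" "G \<subseteq> t ` {..m}" and A: "\<And>s. A s \<in> sets borel"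
  shows "\<exists>B\<in>sets (PiM ({i} \<times> {..<m}) (\<lambda>_. borel)).
    {\<omega>\<in>space M. \<forall>s\<in>G. W i s \<omega> \<in> A s} =
    (\<lambda>\<omega>. restrict (\<lambda>p. (case p of (i, j) \<Rightarrow> \<lambda>\<omega>. W i (t (Suc j)) \<omega> - W i (t j) \<omega>) \<omega>) ({i} \<times> {..<m})) -` B \<inter> space M"
proof -
  define P where "P = PiM ({i} \<times> {..<m}) (\<lambda>_. borel :: real measure)"
  have "\<exists>k\<le>m. t k = s" if "s \<in> G" for s using G(2) that by auto
  then obtain k where k: "\<And>s. s \<in> G \<Longrightarrow> k s \<le> m" "\<And>s. s \<in> G \<Longrightarrow> t (k s) = s" by metis
  define B where "B = {f \<in> space P. \<forall>s\<in>G. (\<Sum>j<k s. f (i, j)) \<in> A s}"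
  have "(\<lambda>f. \<Sum>j<k s. f (i, j)) \<in> borel_measurable P" if "s \<in> G" for s
    unfolding P_def using k(1)[OF that]
    by (intro borel_measurable_sum measurable_component_singleton) auto
  then have "{f \<in> space P. (\<Sum>j<k s. f (i, j)) \<in> A s} \<in> sets P" if "s \<in> G" for s
    using measurable_sets[of "\<lambda>f. \<Sum>j<k s. f (i, j)" P borel "A s"] A that
    by (simp add: vimage_def Int_def conj_commute)
  then have "B \<in> sets P"
    unfolding B_def using G(1) by (intro sets.sets_Collect_finite_All)
  moreover have "{\<omega>\<in>space M. \<forall>s\<in>G. W i s \<omega> \<in> A s} =
    (\<lambda>\<omega>. restrict (\<lambda>p. (case p of (i, j) \<Rightarrow> \<lambda>\<omega>. W i (t (Suc j)) \<omega> - W i (t j) \<omega>) \<omega>) ({i} \<times> {..<m})) -` B \<inter> space M"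
    (is "?L = ?f -` B \<inter> _")
  proof -
    have sum: "(\<Sum>j<k s. ?f \<omega> (i, j)) = W i s \<omega>" if "\<omega> \<in> space M" "s \<in> G" for \<omega> s
    proof -
      have "(\<Sum>j<k s. ?f \<omega> (i, j)) = (\<Sum>j<k s. W i (t (Suc j)) \<omega> - W i (t j) \<omega>)"
        using k(1)[OF that(2)] by (intro sum.cong) auto
      also have "\<dots> = W i s \<omega>"
        using sum_lessThan_telescope[of "\<lambda>j. W i (t j) \<omega>" "k s"] t k(2)[OF that(2)] W_zero[OF that(1)] by simp
      finally show ?thesis .
    qed
    have "?f \<omega> \<in> space P" for \<omega> unfolding P_def by (auto simp: space_PiM)
    then show ?thesis unfolding B_def using sum by auto
  qed
  ultimately show ?thesis unfolding P_def by blast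
qed

text \<open>It suffices to test cylinders. Finitely many of them share one partition, and the
  increments of different coordinates along it are disjoint blocks of an independent family.\<close>

lemma indep_path_algebras: "indep_sets (\<lambda>i. sets (path_algebra i {0..})) UNIV"
  unfolding sets_path_algebra
proof (rule indep_sets_sigma[OF indep_setsI])
  fix C :: "'k \<Rightarrow> 'a set" and J :: "'k set"
  assume J: "J \<noteq> {}" "finite J" and C: "\<forall>j\<in>J. C j \<in> cylinders j {0..}"
  define is_rep where "is_rep j G A \<longleftrightarrow> C j = {\<omega>\<in>space M. \<forall>s\<in>G. W j s \<omega> \<in> A s} \<and>
    finite G \<and> G \<subseteq> {0..} \<and> (\<forall>s. A s \<in> sets borel)" for j G and A :: "real \<Rightarrow> real set"
  have "\<exists>G A. is_rep j G A" if "j \<in> J" for j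
    using C that unfolding cylinders_def is_rep_def by blast
  then obtain G A where rep: "\<And>j. j \<in> J \<Longrightarrow> is_rep j (G j) (A j)"
    by metis
  have CGA: "\<And>j. j \<in> J \<Longrightarrow> C j = {\<omega>\<in>space M. \<forall>s\<in>G j. W j s \<omega> \<in> A j s}"
    and G: "\<And>j. j \<in> J \<Longrightarrow> finite (G j)" "\<And>j. j \<in> J \<Longrightarrow> G j \<subseteq> {0..}"
    and A: "\<And>j s. j \<in> J \<Longrightarrow> A j s \<in> sets borel"
    using rep unfolding is_rep_def by blast+
  \<comment> \<open>The inserted \<open>0\<close> keeps \<open>H\<close> nonempty, so that
    \<open>Max H\<close> exists and is nonnegative.\<close>
  define H where "H = insert 0 (\<Union>j\<in>J. G j)"
  have H: "finite H" "H \<subseteq> {0..}" unfolding H_def using J G by auto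
  obtain t m where t: "t (0::nat) = 0" "\<And>j. j < m \<Longrightarrow> t j < t (Suc j)" "H \<subseteq> t ` {..m}"
  proof (rule finite_subset_partition[of H "Max H"])
    have "0 \<in> H" by (simp add: H_def)
    then show "H \<subseteq> {0..Max H}" "0 \<le> Max H" using H(2) Max_ge[OF H(1)] by auto
  qed (use H in auto)
  let ?f = "\<lambda>i \<omega>. restrict (\<lambda>p. (case p of (i, j) \<Rightarrow> \<lambda>\<omega>. W i (t (Suc j)) \<omega> - W i (t j) \<omega>) \<omega>) ({i} \<times> {..<m})"
  have "\<exists>B\<in>sets (PiM ({i} \<times> {..<m}) (\<lambda>_. borel)). C i = ?f i -` B \<inter> space M" if "i \<in> J" for i
  proof -
    have "G i \<subseteq> t ` {..m}" using t(3) that unfolding H_def by blast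
    then show ?thesis
      unfolding CGA[OF that] by (intro cylinder_as_increments t(1) G(1) A that)
  qed
  then have "\<forall>i\<in>J. \<exists>B. B \<in> sets (PiM ({i} \<times> {..<m}) (\<lambda>_. borel)) \<and> C i = ?f i -` B \<inter> space M"
    by blast
  from bchoice[OF this] obtain B where B: "\<And>i. i \<in> J \<Longrightarrow> B i \<in> sets (PiM ({i} \<times> {..<m}) (\<lambda>_. borel))"
    "\<And>i. i \<in> J \<Longrightarrow> C i = ?f i -` B i \<inter> space M" by blast
  have "indep_vars (\<lambda>i. PiM ({i} \<times> {..<m}) (\<lambda>_. borel)) ?f J"
    by (rule indep_vars_restrict[OF indep_increments[of t m]]) (auto simp: t disjoint_family_on_def)
  from indep_varsD[OF this J(1,2) subset_refl, of B] B
  show "prob (\<Inter>j\<in>J. C j) = (\<Prod>j\<in>J. prob (C j))" by simp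
qed (use cylinders_events Int_stable_cylinders in auto)

text \<open>Cylinders up to \<open>u\<close> depend on the increments of index below
  \<open>m\<close> of a partition ending at \<open>u\<close>; once \<open>v\<close> is appended, the
  later increment has index \<open>m\<close> and forms a disjoint block.\<close>

lemma indep_past_increment:
  assumes "0 \<le> u" "u < v"
  shows "indep_set (sets (path_algebra i {0..u}))
    (sigma_sets (space M) {(\<lambda>\<omega>. W i v \<omega> - W i u \<omega>) -` D \<inter> space M | D. D \<in> sets borel})"
  unfolding sets_path_algebra
proof (rule indep_set_sigma_sets[OF indep_setI])
  show "{(\<lambda>\<omega>. W i v \<omega> - W i u \<omega>) -` D \<inter> space M | D. D \<in> sets borel} \<subseteq> events"
    by (auto intro!: measurable_sets_borel) 
  show "Int_stable {(\<lambda>\<omega>. W i v \<omega> - W i u \<omega>) -` D \<inter> space M | D. D \<in> sets borel}"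
  proof (rule Int_stableI, safe)
    fix D E :: "real set" assume "D \<in> sets borel" "E \<in> sets borel"
    then show "\<exists>F. ((\<lambda>\<omega>. W i v \<omega> - W i u \<omega>) -` D \<inter> space M) \<inter>
        ((\<lambda>\<omega>. W i v \<omega> - W i u \<omega>) -` E \<inter> space M) =
        (\<lambda>\<omega>. W i v \<omega> - W i u \<omega>) -` F \<inter> space M \<and> F \<in> sets borel"
      by (intro exI[of _ "D \<inter> E"]) auto
  qed
  fix C F assume C0: "C \<in> cylinders i {0..u}"
    and F: "F \<in> {(\<lambda>\<omega>. W i v \<omega> - W i u \<omega>) -` D \<inter> space M | D. D \<in> sets borel}"
  obtain G A where C: "C = {\<omega>\<in>space M. \<forall>s\<in>G. W i s \<omega> \<in> A s}" "finite G" "G \<subseteq> {0..u}" "\<And>s. A s \<in> sets borel"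
    by (rule cylindersE[OF C0]) blast
  obtain D where D: "D \<in> sets borel" "F = (\<lambda>\<omega>. W i v \<omega> - W i u \<omega>) -` D \<inter> space M"
    using F by blast
  obtain t0 m where t0: "t0 (0::nat) = 0" "\<And>j. j < m \<Longrightarrow> t0 j < t0 (Suc j)" "t0 m = u" "G \<subseteq> t0 ` {..m}"
    by (rule finite_subset_partition[OF C(2,3) assms(1)]) blast
  define t where "t j = (if j \<le> m then t0 j else v)" for j
  have t_less: "t j < t (Suc j)" if "j < Suc m" for j
    using t0 assms that by (cases "j = m") (auto simp: t_def)
  have t: "t 0 = 0" "G \<subseteq> t ` {..m}" "t m = u" "t (Suc m) = v"
    using t0 by (force simp: t_def)+
  let ?X = "\<lambda>p. case p of (i, j) \<Rightarrow> \<lambda>\<omega>. W i (t (Suc j)) \<omega> - W i (t j) \<omega>"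
  let ?f = "\<lambda>\<omega>. restrict (\<lambda>p. ?X p \<omega>) ({i} \<times> {..<m})" and ?g = "\<lambda>\<omega>. restrict (\<lambda>p. ?X p \<omega>) {(i, m)}"
  obtain B where B: "B \<in> sets (PiM ({i} \<times> {..<m}) (\<lambda>_. borel))" "C = ?f -` B \<inter> space M"
    using cylinder_as_increments[of t G m A i] t C by auto
  define E where "E = {f \<in> space (PiM {(i, m)} (\<lambda>_. borel :: real measure)). f (i, m) \<in> D}"
  have E: "E \<in> sets (PiM {(i, m)} (\<lambda>_. borel))"
    unfolding E_def using D(1) by measurable
  have F: "F = ?g -` E \<inter> space M"
    unfolding D(2) E_def by (auto simp: space_PiM t)
  have "indep_var (PiM ({i} \<times> {..<m}) (\<lambda>_. borel)) ?f (PiM {(i, m)} (\<lambda>_. borel)) ?g"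
    by (rule indep_var_restrict[OF indep_increments[of t "Suc m"]]) (auto simp: t t_less)
  from indep_varD[OF this B(1) E]
  have "prob ((\<lambda>\<omega>. (?f \<omega>, ?g \<omega>)) -` (B \<times> E) \<inter> space M) = prob C * prob F"
    unfolding B(2) F .
  moreover have "(\<lambda>\<omega>. (?f \<omega>, ?g \<omega>)) -` (B \<times> E) \<inter> space M = C \<inter> F"
    unfolding B(2) F by blast
  ultimately show "prob (C \<inter> F) = prob C * prob F" by simp
qed (use cylinders_events Int_stable_cylinders in auto)

end

section \<open>Optional stopping\<close>

text \<open>The integral of the grid increments of \<open>b\<close> against the indicator of not having left yet
  telescopes to \<open>b\<close> at the first grid point after the truncated exit time.\<close>
definition stopped_sum :: "(real \<Rightarrow> real) \<Rightarrow> (real \<Rightarrow> real) \<Rightarrow> real \<Rightarrow> real \<Rightarrow> nat \<Rightarrow> real" where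
  "stopped_sum w b a T N =
    (\<Sum>k<N. (b (T * real (Suc k) / real N) - b (T * real k / real N)) *
      (if confined w a (T * real k / real N) then 1 else 0))"

text \<open>The minimum of the exit time and \<open>T\<close>; the case split keeps out the
  unspecified exit time of paths that never leave.\<close>

definition exit_by :: "(real \<Rightarrow> real) \<Rightarrow> real \<Rightarrow> real \<Rightarrow> real" where
  "exit_by w a T = (if confined w a T then T else exit_time w a)"

text \<open>The equivalence is restricted to \<open>s < T\<close> because a path that stays inside
  up to \<open>T\<close> is stopped at \<open>T\<close>, so it fails at
  \<open>s = T\<close>.\<close>

lemma exit_by_props:
  assumes cont: "continuous_on {0..} w" and w0: "w 0 = 0" and a: "0 < a" and T: "0 < T"
  shows exit_by_mem: "exit_by w a T \<in> {0..T}"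
    and confined_iff_exit_by: "0 \<le> s \<Longrightarrow> s < T \<Longrightarrow> confined w a s \<longleftrightarrow> s < exit_by w a T"
    and at_exit_by: "w (exit_by w a T) \<in> {-1..a}"
proof -
  have *: "exit_by w a T \<in> {0..T} \<and> (0 \<le> s \<longrightarrow> s < T \<longrightarrow> (confined w a s \<longleftrightarrow> s < exit_by w a T)) \<and>
    w (exit_by w a T) \<in> {-1..a}" for s
  proof (cases "confined w a T")
    case True
    then show ?thesis
      using T confined_antimono[OF True] unfolding exit_by_def
      by (auto simp: confined_def dest!: bspec[of _ _ T])
  next
    case False
    note p = exit_time_props[OF cont w0 _ False]
    have 1: "0 \<le> exit_time w a" "exit_time w a \<le> T" using p(1,2) a by auto
    have 2: "-1 < w r \<and> w r < a" if "0 \<le> r" "r < exit_time w a" for r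
      using p(3) a that by auto
    have 3: "w (exit_time w a) = a \<or> w (exit_time w a) = -1" using p(4) a by auto
    have "confined w a s \<longleftrightarrow> s < exit_time w a" if "0 \<le> s"
    proof
      assume c: "confined w a s"
      show "s < exit_time w a"
      proof (rule ccontr)
        assume "\<not> s < exit_time w a"
        then have "-1 < w (exit_time w a) \<and> w (exit_time w a) < a"
          using c 1 unfolding confined_def by auto
        then show False using 3 by auto
      qed
    next
      assume "s < exit_time w a"
      then show "confined w a s" unfolding confined_def using 2 by auto
    qed
    then show ?thesis using 1 3 a False unfolding exit_by_def by auto
  qed
  from * show "exit_by w a T \<in> {0..T}" by blast
  from * show "0 \<le> s \<Longrightarrow> s < T \<Longrightarrow> confined w a s \<longleftrightarrow> s < exit_by w a T" by blast
  from * show "w (exit_by w a T) \<in> {-1..a}" by blast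
qed

text \<open>Terms before the truncated exit are full increments and later ones vanish, so the sum
  telescopes to the first grid point not before it. The integrator \<open>b\<close> is separate from
  \<open>w\<close>: the exit concerns the path, the martingale is its centred version.\<close>

lemma stopped_sum_eq:
  assumes cont: "continuous_on {0..} w" and w0: "w 0 = 0" and a: "0 < a" and T: "0 < T"
    and b0: "b 0 = 0" and N: "0 < N"
  obtains K where "K \<le> N" "stopped_sum w b a T N = b (T * real K / real N)"
    "exit_by w a T \<le> T * real K / real N" "T * real K / real N \<le> exit_by w a T + T / real N"
    "\<And>k. k < K \<Longrightarrow> confined w a (T * real k / real N)"
proof -
  define r where "r = exit_by w a T"
  have r: "0 \<le> r" "r \<le> T" using exit_by_mem[OF cont w0 a T] by (auto simp: r_def)
  \<comment> \<open>The number of grid points strictly before \<open>r\<close>, as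
    \<open>iff\<close> confirms, and hence the index of the first one not before
    \<open>r\<close>.\<close>
  define K where "K = nat \<lceil>r * real N / T\<rceil>"
  have nonneg: "0 \<le> r * real N / T" using r T by simp
  have K: "real K = of_int \<lceil>r * real N / T\<rceil>" unfolding K_def using nonneg by simp
  have "r * real N / T \<le> real N" using r T N by (simp add: field_simps)
  then have KN: "K \<le> N" unfolding K_def by (simp add: nat_le_iff ceiling_le_iff)
  have iff: "k < K \<longleftrightarrow> T * real k / real N < r" for k
  proof -
    have "k < K \<longleftrightarrow> int k < \<lceil>r * real N / T\<rceil>" unfolding K_def by (simp add: zless_nat_eq_int_zless)
    also have "\<dots> \<longleftrightarrow> real k < r * real N / T" by (simp add: less_ceiling_iff)
    also have "\<dots> \<longleftrightarrow> T * real k / real N < r" using T N by (simp add: field_simps)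
    finally show ?thesis .
  qed
  have conf: "confined w a (T * real k / real N) \<longleftrightarrow> k < K" if "k < N" for k
  proof -
    have "0 \<le> T * real k / real N" "T * real k / real N < T" using T N that by (auto simp: field_simps)
    then show ?thesis using confined_iff_exit_by[OF cont w0 a T] iff by (simp add: r_def)
  qed
  have "stopped_sum w b a T N = (\<Sum>k<N. if k < K then b (T * real (Suc k) / real N) - b (T * real k / real N) else 0)"
    unfolding stopped_sum_def by (intro sum.cong) (auto simp: conf)
  also have "\<dots> = (\<Sum>k<K. b (T * real (Suc k) / real N) - b (T * real k / real N))"
    using KN by (subst sum.inter_filter[symmetric]) (auto intro!: sum.cong)
  also have "\<dots> = b (T * real K / real N)"
    using sum_lessThan_telescope[of "\<lambda>k. b (T * real k / real N)" K] b0 by simp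
  finally have "stopped_sum w b a T N = b (T * real K / real N)" .
  moreover have "r \<le> T * real K / real N"
    using iff[of K] by simp
  moreover have "T * real K / real N \<le> r + T / real N"
  proof -
    have "real K \<le> r * real N / T + 1" unfolding K using of_int_ceiling_le_add_one by blast
    then have "T * real K / real N \<le> T * (r * real N / T + 1) / real N"
      using T N by (intro divide_right_mono mult_left_mono) auto
    also have "\<dots> = r + T / real N" using T N by (simp add: field_simps)
    finally show ?thesis .
  qed
  ultimately show ?thesis using that[of K] KN conf unfolding r_def by auto
qed

text \<open>The grid point reached lies at most one mesh width to the right of the truncated exit
  time, so continuity of \<open>b\<close> gives the limit.\<close>

lemma stopped_sum_tendsto:
  assumes cont: "continuous_on {0..} w" and w0: "w 0 = 0" and a: "0 < a" and T: "0 < T"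
    and b0: "b 0 = 0" and b: "continuous_on {0..} b"
  shows "(\<lambda>n. stopped_sum w b a T (Suc n)) \<longlonglongrightarrow> b (exit_by w a T)"
proof -
  have "\<exists>x. stopped_sum w b a T (Suc n) = b x \<and> exit_by w a T \<le> x \<and> x \<le> exit_by w a T + T / real (Suc n)" for n
    by (rule stopped_sum_eq[where w=w and b=b, OF cont w0 a T b0, of "Suc n"]) auto
  then obtain x where x: "\<And>n. stopped_sum w b a T (Suc n) = b (x n)"
    "\<And>n. exit_by w a T \<le> x n" "\<And>n. x n \<le> exit_by w a T + T / real (Suc n)"
    by metis
  have "(\<lambda>n. exit_by w a T + T / real (Suc n)) \<longlonglongrightarrow> exit_by w a T + 0"
    by (intro tendsto_add tendsto_const) (rule LIMSEQ_Suc[OF lim_const_over_n])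
  then have "x \<longlonglongrightarrow> exit_by w a T"
    using x by (intro tendsto_sandwich[of "\<lambda>_. exit_by w a T" x sequentially]) auto
  moreover have "0 \<le> exit_by w a T" using exit_by_mem[OF cont w0 a T] by simp
  ultimately have "(\<lambda>n. b (x n)) \<longlonglongrightarrow> b (exit_by w a T)"
    using x(2) by (intro continuous_on_tendsto_compose[OF b]) (auto intro!: always_eventually order_trans[OF _ x(2)])
  then show ?thesis by (simp add: x(1))
qed

text \<open>At the last confined grid point the value is bounded by \<open>C\<close>, and only one
  increment follows. Bounding its square by the sum of all squares takes the place of a maximal
  inequality.\<close>

lemma stopped_sum_square_le:
  assumes cont: "continuous_on {0..} w" and w0: "w 0 = 0" and a: "0 < a" and T: "0 < T"
    and b0: "b 0 = 0" and N: "0 < N"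
    and C: "\<And>s. 0 \<le> s \<Longrightarrow> s \<le> T \<Longrightarrow> confined w a s \<Longrightarrow> \<bar>b s\<bar> \<le> C" and C0: "0 \<le> C"
  shows "(stopped_sum w b a T N)\<^sup>2 \<le>
    2 * C\<^sup>2 + 2 * (\<Sum>k<N. (b (T * real (Suc k) / real N) - b (T * real k / real N))\<^sup>2)"
proof -
  let ?S = "\<Sum>k<N. (b (T * real (Suc k) / real N) - b (T * real k / real N))\<^sup>2"
  have S: "0 \<le> ?S" by (intro sum_nonneg) auto
  obtain K where K: "K \<le> N" "stopped_sum w b a T N = b (T * real K / real N)"
    "\<And>k. k < K \<Longrightarrow> confined w a (T * real k / real N)"
    by (rule stopped_sum_eq[where w=w and b=b, OF cont w0 a T b0 N]) blast
  show ?thesis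
  proof (cases K)
    case 0
    then show ?thesis using K b0 S by simp
  next
    case (Suc j)
    define x where "x = b (T * real j / real N)"
    define y where "y = b (T * real (Suc j) / real N) - b (T * real j / real N)"
    have "0 \<le> T * real j / real N" "T * real j / real N \<le> T"
      using T N K Suc by (auto simp: field_simps)
    then have "\<bar>x\<bar> \<le> C" unfolding x_def using C K(3)[of j] Suc by auto
    then have "x\<^sup>2 \<le> C\<^sup>2" using abs_le_square_iff[of x C] C0 by auto
    moreover have "y\<^sup>2 \<le> ?S"
      unfolding y_def using K(1) Suc by (intro member_le_sum) auto
    moreover have "(x + y)\<^sup>2 \<le> 2 * x\<^sup>2 + 2 * y\<^sup>2"
      using sum_squares_bound[of x y] by (simp add: power2_sum)
    ultimately show ?thesis using K(2) Suc by (simp add: x_def y_def)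
  qed
qed

text \<open>Bounded second moments give uniform integrability: the part truncated at
  \<open>R\<close> is handled by dominated convergence, and the tail costs at most
  \<open>C / R\<close>.\<close>

lemma (in prob_space) tendsto_expectation_L2_bounded:
  fixes X :: "nat \<Rightarrow> 'a \<Rightarrow> real"
  assumes [measurable]: "\<And>n. X n \<in> borel_measurable M"
    and lim: "\<And>\<omega>. \<omega> \<in> space M \<Longrightarrow> (\<lambda>n. X n \<omega>) \<longlonglongrightarrow> 0"
    and int2: "\<And>n. integrable M (\<lambda>\<omega>. (X n \<omega>)\<^sup>2)"
    and le: "\<And>n. expectation (\<lambda>\<omega>. (X n \<omega>)\<^sup>2) \<le> C"
  shows "(\<lambda>n. expectation (X n)) \<longlonglongrightarrow> 0"
proof (rule LIMSEQ_I)
  fix e :: real assume e: "0 < e"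
  have "0 \<le> expectation (\<lambda>\<omega>. (X 0 \<omega>)\<^sup>2)" by simp
  then have C: "0 \<le> C" using le[of 0] by linarith
  \<comment> \<open>Chosen so that \<open>C / R \<le> e / 2\<close>; the added \<open>1\<close>
    keeps \<open>R\<close> positive when \<open>C = 0\<close>.\<close>
  define R where "R = 2 * (C + 1) / e"
  have R: "0 < R" unfolding R_def using C e by simp
  have int: "integrable M (X n)" for n
    by (rule square_integrable_imp_integrable[OF _ int2]) simp
  have intm: "integrable M (\<lambda>\<omega>. min \<bar>X n \<omega>\<bar> R)" for n
    using R by (intro integrable_const_bound[of _ R]) auto
  have "(\<lambda>n. expectation (\<lambda>\<omega>. min \<bar>X n \<omega>\<bar> R)) \<longlonglongrightarrow> expectation (\<lambda>\<omega>. 0)"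
  proof (rule integral_dominated_convergence[where w="\<lambda>_. R"])
    show "AE \<omega> in M. (\<lambda>n. min \<bar>X n \<omega>\<bar> R) \<longlonglongrightarrow> 0"
    proof (rule AE_I2)
      fix \<omega> assume "\<omega> \<in> space M"
      then have "(\<lambda>n. min \<bar>X n \<omega>\<bar> R) \<longlonglongrightarrow> min \<bar>0\<bar> R"
        by (intro tendsto_intros lim)
      then show "(\<lambda>n. min \<bar>X n \<omega>\<bar> R) \<longlonglongrightarrow> 0" using R by simp
    qed
  qed (use R in auto)
  then have "\<forall>\<^sub>F n in sequentially. expectation (\<lambda>\<omega>. min \<bar>X n \<omega>\<bar> R) < e / 2"
    using e by (intro order_tendstoD(2)) auto
  then obtain n0 where n0: "\<And>n. n0 \<le> n \<Longrightarrow> expectation (\<lambda>\<omega>. min \<bar>X n \<omega>\<bar> R) < e / 2"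
    by (auto simp: eventually_sequentially)
  show "\<exists>n0. \<forall>n\<ge>n0. norm (expectation (X n) - 0) < e"
  proof (intro exI allI impI)
    fix n assume n: "n0 \<le> n"
    have *: "\<bar>x\<bar> \<le> min \<bar>x\<bar> R + x\<^sup>2 / R" for x :: real
    proof (cases "\<bar>x\<bar> \<le> R")
      case False
      then have "\<bar>x\<bar> * R \<le> \<bar>x\<bar> * \<bar>x\<bar>" by (intro mult_left_mono) auto
      then have "\<bar>x\<bar> \<le> x\<^sup>2 / R" using R by (simp add: le_divide_eq power2_eq_square)
      then show ?thesis using R by (auto simp: min_def)
    qed (use R in simp)
    have "norm (expectation (X n)) \<le> expectation (\<lambda>\<omega>. \<bar>X n \<omega>\<bar>)"
      using integral_norm_bound[of M "X n"] by simp
    also have "\<dots> \<le> expectation (\<lambda>\<omega>. min \<bar>X n \<omega>\<bar> R + (X n \<omega>)\<^sup>2 / R)"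
      using int intm int2 * by (intro integral_mono) auto
    also have "\<dots> = expectation (\<lambda>\<omega>. min \<bar>X n \<omega>\<bar> R) + expectation (\<lambda>\<omega>. (X n \<omega>)\<^sup>2) / R"
      using intm int2 by simp
    also have "\<dots> < e / 2 + C / R"
      using n0[OF n] le[of n] R by (intro add_less_le_mono divide_right_mono) auto
    also have "\<dots> \<le> e / 2 + e / 2"
    proof (rule add_left_mono)
      have "C / R = e / 2 * (C / (C + 1))" unfolding R_def using C e by (simp add: field_simps)
      also have "\<dots> \<le> e / 2 * 1" using C e by (intro mult_left_mono) auto
      finally show "C / R \<le> e / 2" by simp
    qed
    finally show "norm (expectation (X n) - 0) < e" by simp
  qed
qed

section \<open>Martingale property, optional stopping and hitting probabilities\<close>

context drifted_BMs
begin

lemma increment_moments: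
  assumes "0 \<le> u" "u < v"
  shows integrable_increment: "integrable M (\<lambda>\<omega>. W i v \<omega> - W i u \<omega>)"
    and expectation_increment: "expectation (\<lambda>\<omega>. W i v \<omega> - W i u \<omega>) = mu i * (v - u)"
    and integrable_increment_square:
      "integrable M (\<lambda>\<omega>. (W i v \<omega> - W i u \<omega> - mu i * (v - u))\<^sup>2)"
    and expectation_increment_square:
      "expectation (\<lambda>\<omega>. (W i v \<omega> - W i u \<omega> - mu i * (v - u))\<^sup>2) = v - u"
proof -
  have s: "0 < sqrt (v - u)" using assms by simp
  note D = distributed_increment[OF assms, of i]
  show "integrable M (\<lambda>\<omega>. W i v \<omega> - W i u \<omega>)"
    using distributed_integrable[OF D, of "\<lambda>x. x"] integrable_normal_moment_nz_1[OF s] by simp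
  show E: "expectation (\<lambda>\<omega>. W i v \<omega> - W i u \<omega>) = mu i * (v - u)"
    by (rule normal_distributed_expectation[OF s D])
  show "integrable M (\<lambda>\<omega>. (W i v \<omega> - W i u \<omega> - mu i * (v - u))\<^sup>2)"
    using distributed_integrable[OF D, of "\<lambda>x. (x - mu i * (v - u))\<^sup>2"]
      integrable_normal_moment[OF s, of "mu i * (v - u)" 2] by simp
  show "expectation (\<lambda>\<omega>. (W i v \<omega> - W i u \<omega> - mu i * (v - u))\<^sup>2) = v - u"
    using normal_distributed_variance[OF s D] assms unfolding E by simp
qed

text \<open>The martingale property tested on past events: the indicator is independent of the
  centred increment, so the mean factors and one factor is zero.\<close>

lemma expectation_past_increment:
  assumes C: "C \<in> sets (path_algebra i {0..u})" and u: "0 \<le> u" "u < v"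
  shows "integrable M (\<lambda>\<omega>. (W i v \<omega> - W i u \<omega> - mu i * (v - u)) * indicator C \<omega>)"
    and "expectation (\<lambda>\<omega>. (W i v \<omega> - W i u \<omega> - mu i * (v - u)) * indicator C \<omega>) = 0"
proof -
  note ind = indep_past_increment[OF u, of i]
  have [measurable]: "C \<in> events" using indep_setD_ev1[OF ind] C by auto
  have "indep_var borel (indicator C :: 'a \<Rightarrow> real) borel (\<lambda>\<omega>. W i v \<omega> - W i u \<omega>)"
    unfolding indep_var_eq
  proof (intro conjI)
    have "sigma_sets (space M) {(indicator C :: 'a \<Rightarrow> real) -` A \<inter> space M | A. A \<in> sets borel}
        \<subseteq> sets (path_algebra i {0..u})"
    proof -
      have "(indicator C :: 'a \<Rightarrow> real) -` A \<inter> space M \<in> sets (path_algebra i {0..u})" if "A \<in> sets borel" for A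
        using measurable_sets[OF borel_measurable_indicator[OF C] that] by simp
      then show ?thesis
        using sets.sigma_sets_subset[of "{(indicator C :: 'a \<Rightarrow> real) -` A \<inter> space M | A. A \<in> sets borel}" "path_algebra i {0..u}"]
        by auto
    qed
    then show "indep_set (sigma_sets (space M) {(indicator C :: 'a \<Rightarrow> real) -` A \<inter> space M | A. A \<in> sets borel})
        (sigma_sets (space M) {(\<lambda>\<omega>. W i v \<omega> - W i u \<omega>) -` A \<inter> space M | A. A \<in> sets borel})"
      using ind unfolding indep_set_def
      by (elim indep_sets_mono_sets) (auto split: bool.split)
  qed measurable
  from indep_var_compose[OF this, of "\<lambda>x. x" borel "\<lambda>x. x - mu i * (v - u)" borel]
  have "indep_var borel (indicator C :: 'a \<Rightarrow> real) borel (\<lambda>\<omega>. W i v \<omega> - W i u \<omega> - mu i * (v - u))"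
    by (simp add: comp_def)
  moreover have "integrable M (\<lambda>\<omega>. W i v \<omega> - W i u \<omega> - mu i * (v - u))"
    using integrable_increment[OF u] by simp
  moreover have "integrable M (indicator C :: 'a \<Rightarrow> real)" by (simp add: emeasure_eq_measure)
  moreover have "expectation (\<lambda>\<omega>. W i v \<omega> - W i u \<omega> - mu i * (v - u)) = 0"
    using expectation_increment[OF u] integrable_increment[OF u] by (simp add: prob_space)
  ultimately show "integrable M (\<lambda>\<omega>. (W i v \<omega> - W i u \<omega> - mu i * (v - u)) * indicator C \<omega>)"
    and "expectation (\<lambda>\<omega>. (W i v \<omega> - W i u \<omega> - mu i * (v - u)) * indicator C \<omega>) = 0"
    using indep_var_integrable[of "indicator C :: 'a \<Rightarrow> real" "\<lambda>\<omega>. W i v \<omega> - W i u \<omega> - mu i * (v - u)"]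
      indep_var_lebesgue_integral[of "indicator C :: 'a \<Rightarrow> real" "\<lambda>\<omega>. W i v \<omega> - W i u \<omega> - mu i * (v - u)"]
    by (simp_all add: mult.commute)
qed

text \<open>Confinement up to \<open>u\<close> is decided by the past, so the integrand of
  \<open>stopped_sum\<close> is known at the left end of each grid step.\<close>

lemma sets_path_confined:
  "{\<omega>\<in>space M. confined (\<lambda>s. W i s \<omega>) a u} \<in> sets (path_algebra i {0..u})"
  using sets_confined[of u "W i" "path_algebra i {0..u}" a] measurable_W_path_algebra
    continuous_on_atLeast_Icc[OF W_cont] by simp

text \<open>The centred motion; the argument order makes \<open>BM0 i \<omega>\<close> a path that
  can be the integrator of \<open>stopped_sum\<close>.\<close>

definition BM0 :: "'k \<Rightarrow> 'a \<Rightarrow> real \<Rightarrow> real" where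
  "BM0 i \<omega> t = W i t \<omega> - mu i * t"

text \<open>A discrete martingale transform: each summand is the indicator of a past event times a
  centred increment.\<close>

lemma expectation_stopped_sum:
  assumes T: "0 < T" and N: "0 < N"
  shows integrable_stopped_sum: "integrable M (\<lambda>\<omega>. stopped_sum (\<lambda>s. W i s \<omega>) (BM0 i \<omega>) a T N)"
    and "expectation (\<lambda>\<omega>. stopped_sum (\<lambda>s. W i s \<omega>) (BM0 i \<omega>) a T N) = 0"
proof -
  define u where "u k = T * real k / real N" for k
  define C where "C k = {\<omega>\<in>space M. confined (\<lambda>s. W i s \<omega>) a (u k)}" for k
  have u: "0 \<le> u k" "u k < u (Suc k)" for k
    using T N by (auto simp: u_def divide_strict_right_mono)
  have "C k \<in> sets (path_algebra i {0..u k})" for k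
    unfolding C_def by (rule sets_path_confined)
  note E = expectation_past_increment[OF this u]
  have eq: "stopped_sum (\<lambda>s. W i s \<omega>) (BM0 i \<omega>) a T N =
    (\<Sum>k<N. (W i (u (Suc k)) \<omega> - W i (u k) \<omega> - mu i * (u (Suc k) - u k)) * indicator (C k) \<omega>)"
    if "\<omega> \<in> space M" for \<omega>
    unfolding stopped_sum_def u_def[symmetric] using that
    by (intro sum.cong) (auto simp: BM0_def C_def algebra_simps)
  have "integrable M (\<lambda>\<omega>. stopped_sum (\<lambda>s. W i s \<omega>) (BM0 i \<omega>) a T N) \<longleftrightarrow> integrable M
    (\<lambda>\<omega>. \<Sum>k<N. (W i (u (Suc k)) \<omega> - W i (u k) \<omega> - mu i * (u (Suc k) - u k)) * indicator (C k) \<omega>)"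
    by (rule Bochner_Integration.integrable_cong[OF refl eq])
  then show "integrable M (\<lambda>\<omega>. stopped_sum (\<lambda>s. W i s \<omega>) (BM0 i \<omega>) a T N)"
    by (rule iffD2) (intro Bochner_Integration.integrable_sum E(1))
  have "expectation (\<lambda>\<omega>. stopped_sum (\<lambda>s. W i s \<omega>) (BM0 i \<omega>) a T N) = expectation
    (\<lambda>\<omega>. \<Sum>k<N. (W i (u (Suc k)) \<omega> - W i (u k) \<omega> - mu i * (u (Suc k) - u k)) * indicator (C k) \<omega>)"
    by (rule Bochner_Integration.integral_cong[OF refl eq])
  then show "expectation (\<lambda>\<omega>. stopped_sum (\<lambda>s. W i s \<omega>) (BM0 i \<omega>) a T N) = 0"
    by (subst (asm) Bochner_Integration.integral_sum) (auto simp: E simp del: sum_mult_indicator)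
qed

text \<open>The grid sums have mean zero and tend to the stopped value as the mesh shrinks; a
  uniform second-moment bound lets the mean pass to the limit.\<close>

lemma optional_stopping:
  assumes a: "0 < a" and T: "0 < T"
  shows integrable_BM0_exit_by: "integrable M (\<lambda>\<omega>. BM0 i \<omega> (exit_by (\<lambda>s. W i s \<omega>) a T))"
    and "expectation (\<lambda>\<omega>. BM0 i \<omega> (exit_by (\<lambda>s. W i s \<omega>) a T)) = 0"
proof -
  define Y where "Y \<omega> = BM0 i \<omega> (exit_by (\<lambda>s. W i s \<omega>) a T)" for \<omega>
  define S where "S n \<omega> = stopped_sum (\<lambda>s. W i s \<omega>) (BM0 i \<omega>) a T (Suc n)" for n \<omega>
  define D where "D n k \<omega> = (BM0 i \<omega> (T * real (Suc k) / real (Suc n)) - BM0 i \<omega> (T * real k / real (Suc n)))\<^sup>2" for n k \<omega>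
  \<comment> \<open>Up to the truncated exit the path lies in \<open>{-1..a}\<close> and the drift
    contributes at most \<open>\<bar>mu i\<bar> * T\<close>.\<close>
  define C where "C = 1 + a + \<bar>mu i\<bar> * T"
  have C0: "0 \<le> C" using a T by (simp add: C_def)
  have S_int: "integrable M (S n)" and S_exp: "expectation (S n) = 0" for n
    unfolding S_def using expectation_stopped_sum[OF T] by auto
  have [measurable]: "S n \<in> borel_measurable M" for n
    using S_int by auto
  have lim: "(\<lambda>n. S n \<omega>) \<longlonglongrightarrow> Y \<omega>" if "\<omega> \<in> space M" for \<omega>
    unfolding S_def Y_def
    by (rule stopped_sum_tendsto[OF W_cont[OF that] W_zero[OF that] a T])
      (use W_zero[OF that] W_cont[OF that] in \<open>auto simp: BM0_def intro!: continuous_intros\<close>)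
  have [measurable]: "Y \<in> borel_measurable M"
    by (rule borel_measurable_LIMSEQ_real[OF lim]) auto
  have drift: "\<bar>mu i * s\<bar> \<le> \<bar>mu i\<bar> * T" if "0 \<le> s" "s \<le> T" for s
    using that by (auto simp: abs_mult intro: mult_left_mono)
  have Y_le: "\<bar>Y \<omega>\<bar> \<le> C" if "\<omega> \<in> space M" for \<omega>
    using exit_by_mem[OF W_cont[OF that] W_zero[OF that] a T, of i]
      at_exit_by[OF W_cont[OF that] W_zero[OF that] a T, of i]
      drift[of "exit_by (\<lambda>s. W i s \<omega>) a T"] a
    unfolding Y_def BM0_def C_def by auto
  have Y_int: "integrable M Y"
    using Y_le by (intro integrable_const_bound[of _ C]) auto
  have S_le: "(S n \<omega>)\<^sup>2 \<le> 2 * C\<^sup>2 + 2 * (\<Sum>k<Suc n. D n k \<omega>)" if "\<omega> \<in> space M" for n \<omega>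
    unfolding S_def D_def
  proof (rule stopped_sum_square_le[OF W_cont[OF that] W_zero[OF that] a T _ _ _ C0])
    fix s assume s: "0 \<le> s" "s \<le> T" "confined (\<lambda>s. W i s \<omega>) a s"
    then have "-1 < W i s \<omega> \<and> W i s \<omega> < a" by (auto simp: confined_def)
    then show "\<bar>BM0 i \<omega> s\<bar> \<le> C" using drift[OF s(1,2)] a by (auto simp: BM0_def C_def)
  qed (use W_zero[OF that] in \<open>auto simp: BM0_def\<close>)
  have D: "integrable M (D n k)" "expectation (D n k) = T / real (Suc n)" for n k
  proof -
    define u v where "u = T * real k / real (Suc n)" and "v = T * real (Suc k) / real (Suc n)"
    have uv: "0 \<le> u" "u < v" unfolding u_def v_def using T by (auto simp: divide_strict_right_mono)
    have D_eq: "D n k \<omega> = (W i v \<omega> - W i u \<omega> - mu i * (v - u))\<^sup>2" for \<omega>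
      unfolding D_def u_def[symmetric] v_def[symmetric] BM0_def by (simp add: algebra_simps)
    show "integrable M (D n k)"
      using integrable_increment_square[OF uv, of i] by (simp add: D_eq[abs_def])
    have "v - u = T / real (Suc n)" unfolding u_def v_def
      by (simp add: diff_divide_distrib[symmetric] algebra_simps)
    then show "expectation (D n k) = T / real (Suc n)"
      using expectation_increment_square[OF uv, of i] by (simp add: D_eq[abs_def])
  qed
  \<comment> \<open>The overshoot past the exit time is at most one grid increment, so the sum of squared
    increments, of mean \<open>T\<close>, bounds it in \<open>L\<^sup>2\<close> uniformly in \<open>n\<close>.\<close>
  have X_le: "(S n \<omega> - Y \<omega>)\<^sup>2 \<le> 6 * C\<^sup>2 + 4 * (\<Sum>k<Suc n. D n k \<omega>)" if "\<omega> \<in> space M" for n \<omega>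
  proof -
    have "(S n \<omega> - Y \<omega>)\<^sup>2 \<le> 2 * (S n \<omega>)\<^sup>2 + 2 * (Y \<omega>)\<^sup>2"
      using sum_squares_bound[of "S n \<omega>" "- Y \<omega>"] by (simp add: power2_diff)
    moreover have "(Y \<omega>)\<^sup>2 \<le> C\<^sup>2" using Y_le[OF that] C0 abs_le_square_iff[of "Y \<omega>" C] by auto
    ultimately show ?thesis using S_le[OF that, of n] by simp
  qed
  have bound_int: "integrable M (\<lambda>\<omega>. 6 * C\<^sup>2 + 4 * (\<Sum>k<Suc n. D n k \<omega>))" for n
    using D(1) by (intro Bochner_Integration.integrable_add integrable_mult_right Bochner_Integration.integrable_sum) auto
  have X_int: "integrable M (\<lambda>\<omega>. (S n \<omega> - Y \<omega>)\<^sup>2)" for n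
    by (rule Bochner_Integration.integrable_bound[OF bound_int[of n]])
      (use X_le[of _ n] in \<open>auto intro!: AE_I2 order_trans[OF _ abs_ge_self]\<close>)
  have "(\<lambda>n. expectation (\<lambda>\<omega>. S n \<omega> - Y \<omega>)) \<longlonglongrightarrow> 0"
  proof (rule tendsto_expectation_L2_bounded[OF _ _ X_int])
    fix n
    have "expectation (\<lambda>\<omega>. (S n \<omega> - Y \<omega>)\<^sup>2) \<le> expectation (\<lambda>\<omega>. 6 * C\<^sup>2 + 4 * (\<Sum>k<Suc n. D n k \<omega>))"
      using X_le by (intro integral_mono X_int bound_int)
    also have "\<dots> = 6 * C\<^sup>2 + 4 * (\<Sum>k<Suc n. T / real (Suc n))"
      using D prob_space by (subst Bochner_Integration.integral_add) (auto simp del: sum.lessThan_Suc)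
    also have "\<dots> = 6 * C\<^sup>2 + 4 * T" by (simp del: of_nat_Suc)
    finally show "expectation (\<lambda>\<omega>. (S n \<omega> - Y \<omega>)\<^sup>2) \<le> 6 * C\<^sup>2 + 4 * T" .
  next
    fix \<omega> assume "\<omega> \<in> space M"
    from tendsto_diff[OF lim[OF this] tendsto_const[of "Y \<omega>"]]
    show "(\<lambda>n. S n \<omega> - Y \<omega>) \<longlonglongrightarrow> 0" by simp
  qed measurable
  moreover have "expectation (\<lambda>\<omega>. S n \<omega> - Y \<omega>) = - expectation Y" for n
    using S_int Y_int S_exp by simp
  ultimately have "expectation Y = 0" by (simp add: LIMSEQ_const_iff)
  then show "expectation (\<lambda>\<omega>. BM0 i \<omega> (exit_by (\<lambda>s. W i s \<omega>) a T)) = 0"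
    by (simp add: Y_def[abs_def])
  show "integrable M (\<lambda>\<omega>. BM0 i \<omega> (exit_by (\<lambda>s. W i s \<omega>) a T))"
    using Y_int by (simp add: Y_def[abs_def])
qed

text \<open>The Gaussian density is at most \<open>1 / sqrt T\<close> whatever its mean, which makes
  the bound uniform in the drift.\<close>

lemma prob_W_between_le:
  assumes T: "0 < T" and a: "0 \<le> a"
  shows "prob {\<omega>\<in>space M. -1 < W i T \<omega> \<and> W i T \<omega> < a} \<le> (1 + a) / sqrt T"
proof -
  have "distributed M lborel (\<lambda>\<omega>. W i T \<omega> - W i 0 \<omega>) (normal_density (mu i * (T - 0)) (sqrt (T - 0)))"
    by (rule distributed_increment) (use T in auto)
  note D = this
  have dens: "normal_density (mu i * (T - 0)) (sqrt (T - 0)) x \<le> 1 / sqrt T" for x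
  proof -
    have "1 \<le> sqrt (2 * pi)" using pi_gt3 by (intro real_le_rsqrt) simp
    then have "sqrt T \<le> sqrt (2 * pi * T)" using T by (simp add: real_sqrt_mult mult_le_cancel_right1)
    then have "1 / sqrt (2 * pi * (sqrt (T - 0))\<^sup>2) \<le> 1 / sqrt T" using T by (simp add: frac_le)
    moreover have "exp (- (x - mu i * (T - 0))\<^sup>2 / (2 * (sqrt (T - 0))\<^sup>2)) \<le> 1" by simp
    ultimately have "1 / sqrt (2 * pi * (sqrt (T - 0))\<^sup>2) * exp (- (x - mu i * (T - 0))\<^sup>2 / (2 * (sqrt (T - 0))\<^sup>2)) \<le> 1 / sqrt T * 1"
      by (rule mult_mono) (use T in auto)
    then show ?thesis unfolding normal_density_def by simp
  qed
  have "{\<omega>\<in>space M. -1 < W i T \<omega> \<and> W i T \<omega> < a} =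
      (\<lambda>\<omega>. W i T \<omega> - W i 0 \<omega>) -` {-1<..<a} \<inter> space M"
    using W_zero by auto
  then have "ennreal (prob {\<omega>\<in>space M. -1 < W i T \<omega> \<and> W i T \<omega> < a}) =
      (\<integral>\<^sup>+x. ennreal (normal_density (mu i * (T - 0)) (sqrt (T - 0)) x) * indicator {-1<..<a} x \<partial>lborel)"
    using distributed_emeasure[OF D, of "{-1<..<a}"] by (simp add: emeasure_eq_measure)
  also have "\<dots> \<le> (\<integral>\<^sup>+x. ennreal (1 / sqrt T) * indicator {-1<..<a} x \<partial>lborel)"
    by (intro nn_integral_mono mult_right_mono ennreal_leI dens) auto
  also have "\<dots> = ennreal (1 / sqrt T) * ennreal (1 + a)"
    using a by (simp add: nn_integral_cmult_indicator add.commute)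
  also have "\<dots> = ennreal ((1 + a) / sqrt T)"
    by (subst ennreal_mult[symmetric]) (use a T in auto)
  finally show ?thesis using a T by (simp add: ennreal_le_iff)
qed

lemma sets_path_hits: "{\<omega>\<in>space M. hits (\<lambda>s. W i s \<omega>) a} \<in> sets (path_algebra i {0..})"
  using sets_hits[of "W i" "path_algebra i {0..}" a] measurable_W_path_algebra W_cont by simp

lemma hits_event [measurable]: "{\<omega>\<in>space M. hits (\<lambda>s. W i s \<omega>) a} \<in> events"
  by (rule sets_hits) (auto intro: W_cont)

lemma confined_event [measurable]: "{\<omega>\<in>space M. confined (\<lambda>s. W i s \<omega>) a u} \<in> events"
  by (rule sets_confined) (auto intro: continuous_on_atLeast_Icc W_cont)

text \<open>If the path has left by \<open>T\<close>, then \<open>1 + W\<close> at the exit is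
  \<open>1 + a\<close> on a hit and \<open>0\<close> otherwise, so optional stopping yields the
  probability up to the drift term. Paths still inside at \<open>T\<close> account for the second
  error term.\<close>

lemma prob_hits:
  assumes a: "0 < a" and T: "0 < T"
  shows "\<bar>prob {\<omega>\<in>space M. hits (\<lambda>s. W i s \<omega>) a} - 1 / (1 + a)\<bar> \<le> \<bar>mu i\<bar> * T + (1 + a) / sqrt T"
proof -
  define H where "H = {\<omega>\<in>space M. hits (\<lambda>s. W i s \<omega>) a}"
  define F where "F = {\<omega>\<in>space M. confined (\<lambda>s. W i s \<omega>) a T}"
  define Y where "Y \<omega> = BM0 i \<omega> (exit_by (\<lambda>s. W i s \<omega>) a T)" for \<omega>
  have [measurable]: "H \<in> events" "F \<in> events" unfolding H_def F_def by measurable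
  have Y: "integrable M Y" "expectation Y = 0"
    unfolding Y_def using optional_stopping[OF a T] by auto
  have int: "integrable M (indicator H :: _ \<Rightarrow> real)" "integrable M (indicator F :: _ \<Rightarrow> real)"
    by (auto simp: emeasure_eq_measure)
  have pw: "\<bar>1 + Y \<omega> - (1 + a) * indicator H \<omega>\<bar> \<le> \<bar>mu i\<bar> * T + (1 + a) * indicator F \<omega>"
    if \<omega>: "\<omega> \<in> space M" for \<omega>
  proof -
    define r where "r = exit_by (\<lambda>s. W i s \<omega>) a T"
    have "0 \<le> r" "r \<le> T" using exit_by_mem[OF W_cont[OF \<omega>] W_zero[OF \<omega>] a T] by (auto simp: r_def)
    then have r: "\<bar>mu i * r\<bar> \<le> \<bar>mu i\<bar> * T" by (auto simp: abs_mult intro: mult_left_mono)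
    have Yr: "Y \<omega> = W i r \<omega> - mu i * r" by (simp add: Y_def BM0_def r_def)
    show ?thesis
    proof (cases "confined (\<lambda>s. W i s \<omega>) a T")
      case True
      then have "r = T" by (simp add: r_def exit_by_def)
      then have "-1 < W i r \<omega> \<and> W i r \<omega> < a" using True T by (auto simp: confined_def)
      moreover have "(indicator F \<omega> :: real) = 1" using True \<omega> by (simp add: F_def)
      \<comment> \<open>A path inside at \<open>T\<close> may or may not hit later; in both cases
        the discrepancy is at most \<open>1 + a\<close>, apart from the drift.\<close>
      moreover have "(indicator H \<omega> :: real) = 0 \<or> (indicator H \<omega> :: real) = 1"
        by (auto simp: indicator_def)
      ultimately show ?thesis using Yr r a by auto
    next
      case False
      have r_eq: "r = exit_time (\<lambda>s. W i s \<omega>) a" using False by (simp add: r_def exit_by_def)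
      have "W i r \<omega> = a \<longleftrightarrow> hits (\<lambda>s. W i s \<omega>) a" "W i r \<omega> = a \<or> W i r \<omega> = -1"
        using exit_time_props(4,5)[OF W_cont[OF \<omega>] W_zero[OF \<omega>] _ False] a unfolding r_eq by auto
      moreover have "(indicator F \<omega> :: real) = 0" using False by (simp add: F_def)
      ultimately show ?thesis using Yr r a \<omega> by (auto simp: H_def indicator_def)
    qed
  qed
  have "\<bar>1 - (1 + a) * prob H\<bar> = \<bar>expectation (\<lambda>\<omega>. 1 + Y \<omega> - (1 + a) * indicator H \<omega>)\<bar>"
    using Y int by (simp add: prob_space)
  also have "\<dots> \<le> expectation (\<lambda>\<omega>. \<bar>1 + Y \<omega> - (1 + a) * indicator H \<omega>\<bar>)"
    by (rule integral_abs_bound)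
  also have "\<dots> \<le> expectation (\<lambda>\<omega>. \<bar>mu i\<bar> * T + (1 + a) * indicator F \<omega>)"
    using Y(1) int pw by (intro integral_mono) auto
  also have "\<dots> = \<bar>mu i\<bar> * T + (1 + a) * prob F"
    using int by (simp add: prob_space)
  finally have main: "\<bar>1 - (1 + a) * prob H\<bar> \<le> \<bar>mu i\<bar> * T + (1 + a) * prob F" .
  have "prob F \<le> prob {\<omega>\<in>space M. -1 < W i T \<omega> \<and> W i T \<omega> < a}"
    using T by (intro finite_measure_mono) (auto simp: F_def confined_def)
  also have "\<dots> \<le> (1 + a) / sqrt T" using prob_W_between_le[OF T] a by simp
  finally have F_le: "prob F \<le> (1 + a) / sqrt T" .
  have "prob H - 1 / (1 + a) = - (1 - (1 + a) * prob H) / (1 + a)"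
    using a by (simp add: field_simps)
  then have "\<bar>prob H - 1 / (1 + a)\<bar> = \<bar>1 - (1 + a) * prob H\<bar> / (1 + a)"
    using a by (simp add: abs_divide)
  also have "\<dots> \<le> (\<bar>mu i\<bar> * T + (1 + a) * prob F) / (1 + a)"
    using main a by (intro divide_right_mono) auto
  also have "\<dots> = \<bar>mu i\<bar> * T / (1 + a) + prob F"
    using a by (simp add: field_simps)
  also have "\<dots> \<le> \<bar>mu i\<bar> * T + (1 + a) / sqrt T"
    using F_le a T frac_le[of "\<bar>mu i\<bar> * T" "\<bar>mu i\<bar> * T" 1 "1 + a"] by (intro add_mono) auto
  finally show ?thesis unfolding H_def .
qed

end

section \<open>The false coverage rate\<close>

text \<open>The shared form of the false coverage proportion and of its idealisation by hits, so
  that the two can be compared by \<open>fraction_cong\<close>.\<close>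

definition fraction :: "'k set \<Rightarrow> ('k \<Rightarrow> bool) \<Rightarrow> real" where
  "fraction A P = (\<Sum>i\<in>A. if P i then 1 else 0) / real (max (card A) 1)"

lemma fraction_bounds: "0 \<le> fraction A P" "fraction A P \<le> 1"
proof -
  have "(\<Sum>i\<in>A. if P i then 1 else 0 :: real) \<le> (\<Sum>i\<in>A. 1)"
    by (intro sum_mono) auto
  also have "\<dots> \<le> real (max (card A) 1)" by simp
  finally show "fraction A P \<le> 1" unfolding fraction_def by (simp add: divide_le_eq)
  show "0 \<le> fraction A P" unfolding fraction_def by (intro divide_nonneg_nonneg sum_nonneg) auto
qed

lemma fraction_cong: "A = B \<Longrightarrow> (\<And>i. i \<in> B \<Longrightarrow> P i = Q i) \<Longrightarrow> fraction A P = fraction B Q"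
  unfolding fraction_def by (auto intro: sum.cong)

section \<open>Separating one coordinate from the selection of the others\<close>

context drifted_BMs
begin

definition hit_event :: "'k \<Rightarrow> real \<Rightarrow> 'a set" where
  "hit_event i a = {\<omega>\<in>space M. hits (\<lambda>s. W i s \<omega>) a}"

definition hit_set :: "real \<Rightarrow> 'a \<Rightarrow> 'k set" where
  "hit_set a \<omega> = {i. hits (\<lambda>s. W i s \<omega>) a}"

text \<open>Fixing the exact set, not only its size, makes this an intersection of one event for
  each coordinate other than \<open>i\<close>.\<close>

definition others_event :: "real \<Rightarrow> 'k \<Rightarrow> 'k set \<Rightarrow> 'a set" where
  "others_event a i A = {\<omega>\<in>space M. hit_set a \<omega> - {i} = A}"

lemma hit_event_path: "hit_event i a \<in> sets (path_algebra i {0..})"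
  unfolding hit_event_def by (rule sets_path_hits)

lemma hit_event_events [measurable]: "hit_event i a \<in> events"
  unfolding hit_event_def by measurable

text \<open>Independence holds for whole paths, so the level \<open>c\<close> for coordinate
  \<open>i\<close> may differ from the level \<open>a\<close> for the others.\<close>

lemma prob_hit_others:
  assumes A: "A \<subseteq> UNIV - {i}"
  shows others_event_events: "others_event a i A \<in> events"
    and "prob (hit_event i c \<inter> others_event a i A) = prob (hit_event i c) * prob (others_event a i A)"
proof -
  \<comment> \<open>The slot \<open>B\<close> of coordinate \<open>i\<close> stays variable, so that
    \<open>space M\<close> and \<open>hit_event i c\<close> share one product over the others. In
    that product \<open>E {}\<close> is evaluated only away from \<open>i\<close>.\<close>
  define E where "E B j = (if j = i then B else if j \<in> A then hit_event j a else space M - hit_event j a)" for B j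
  have E_path: "E B j \<in> sets (path_algebra j {0..})" if "B \<in> sets (path_algebra i {0..})" for B j
    using that hit_event_path sets.Diff[OF sets.top hit_event_path] by (auto simp: E_def)
  have Int: "B \<inter> others_event a i A = (\<Inter>j\<in>UNIV. E B j)" if "B \<subseteq> space M" for B
  proof (intro set_eqI)
    fix \<omega>
    show "\<omega> \<in> B \<inter> others_event a i A \<longleftrightarrow> \<omega> \<in> (\<Inter>j\<in>UNIV. E B j)"
    proof
      assume "\<omega> \<in> B \<inter> others_event a i A"
      then show "\<omega> \<in> (\<Inter>j\<in>UNIV. E B j)"
        by (auto simp: E_def others_event_def hit_event_def hit_set_def)
    next
      assume \<omega>: "\<omega> \<in> (\<Inter>j\<in>UNIV. E B j)"
      then have "\<omega> \<in> E B j" for j by auto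
      from this[of i] have B: "\<omega> \<in> B" by (simp add: E_def)
      have "hits (\<lambda>s. W j s \<omega>) a \<longleftrightarrow> j \<in> A" if "j \<noteq> i" for j
        using \<open>\<And>j. \<omega> \<in> E B j\<close>[of j] that by (auto simp: E_def hit_event_def split: if_splits)
      then have "hit_set a \<omega> - {i} = A" using A by (auto simp: hit_set_def)
      then show "\<omega> \<in> B \<inter> others_event a i A"
        using B \<open>B \<subseteq> space M\<close> by (auto simp: others_event_def)
    qed
  qed
  have prod: "prob (B \<inter> others_event a i A) = prob B * (\<Prod>j\<in>UNIV - {i}. prob (E {} j))"
    if B: "B \<in> sets (path_algebra i {0..})" for B
  proof -
    have "B \<subseteq> space M" using sets.sets_into_space[OF B] by simp
    then have "prob (B \<inter> others_event a i A) = prob (\<Inter>j\<in>UNIV. E B j)" by (simp add: Int)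
    also have "\<dots> = (\<Prod>j\<in>UNIV. prob (E B j))"
      by (rule indep_setsD[OF indep_path_algebras]) (use E_path[OF B] in auto)
    also have "\<dots> = prob (E B i) * (\<Prod>j\<in>UNIV - {i}. prob (E B j))"
      by (rule prod.remove) auto
    also have "\<dots> = prob B * (\<Prod>j\<in>UNIV - {i}. prob (E {} j))"
      by (auto simp: E_def intro!: prod.cong)
    finally show ?thesis .
  qed
  have sub: "others_event a i A \<subseteq> space M" by (auto simp: others_event_def)
  have top: "space M \<in> sets (path_algebra i {0..})"
    using sets.top[of "path_algebra i {0..}"] by simp
  have "E (space M) j \<in> events" for j
    by (auto simp: E_def)
  then have "(\<Inter>j\<in>UNIV. E (space M) j) \<in> events"
    by (intro sets.finite_INT) auto
  then show "others_event a i A \<in> events"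
    using Int[OF subset_refl] sub by (simp add: Int_absorb1)
  have "prob (others_event a i A) = (\<Prod>j\<in>UNIV - {i}. prob (E {} j))"
    using prod[OF top] sub by (simp add: prob_space Int_absorb1)
  then show "prob (hit_event i c \<inter> others_event a i A) = prob (hit_event i c) * prob (others_event a i A)"
    using prod[OF hit_event_path] by simp
qed

text \<open>These weights sum to one, which is why the law of the other selections drops out of the
  limit.\<close>

lemma sum_prob_others: "(\<Sum>A\<in>Pow (UNIV - {i}). prob (others_event a i A)) = 1"
proof -
  have "(\<Sum>A\<in>Pow (UNIV - {i}). prob (others_event a i A)) =
      prob (\<Union>A\<in>Pow (UNIV - {i}). others_event a i A)"
    by (intro finite_measure_finite_Union[symmetric])
      (auto simp: disjoint_family_on_def others_event_def[of a i] intro!: others_event_events[unfolded others_event_def])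
  also have "(\<Union>A\<in>Pow (UNIV - {i}). others_event a i A) = space M"
  proof (intro equalityI subsetI)
    fix \<omega> assume "\<omega> \<in> space M"
    then show "\<omega> \<in> (\<Union>A\<in>Pow (UNIV - {i}). others_event a i A)"
      by (intro UN_I[of "hit_set a \<omega> - {i}"]) (auto simp: others_event_def)
  qed (auto simp: others_event_def)
  finally show ?thesis by (simp add: prob_space)
qed

end

section \<open>The e-BY procedure at one fixed drift vector\<close>

locale eBY = drifted_BMs M W mu
  for M :: "'a measure" and W :: "'k::finite \<Rightarrow> real \<Rightarrow> 'a \<Rightarrow> real" and mu :: "'k \<Rightarrow> real" +
  fixes \<delta> \<gamma> :: real
  assumes delta: "0 < \<delta>" "\<delta> < 1" and gamma: "1 \<le> \<gamma>" "\<gamma> < 1 / \<delta>"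
    and mu_neg: "mu i < 0"
begin

text \<open>The barrier \<open>\<beta>\<close> for \<open>s\<close> selected coordinates. By the
  convention for division \<open>level 0\<close> is \<open>0\<close>, but it arises only under sums
  over the empty set.\<close>

definition level :: "nat \<Rightarrow> real" where
  "level s = real CARD('k) / (\<delta> * real s)"

text \<open>The second bound makes every hit of a barrier entail selection; the third lets
  \<open>level 1\<close> serve as a common ceiling for all barriers.\<close>

lemma level_bounds:
  assumes "0 < s" "s \<le> CARD('k)"
  shows "1 < level s" "\<gamma> \<le> level s" "level s \<le> level 1"
proof -
  have "1 / \<delta> \<le> level s"
    using assms delta by (simp add: level_def field_simps)
  moreover have "1 < 1 / \<delta>" using delta by simp
  ultimately show "\<gamma> \<le> level s" "1 < level s" using gamma by linarith+
  show "level s \<le> level 1"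
    unfolding level_def using assms delta by (intro divide_left_mono) auto
qed

definition miss :: "'k \<Rightarrow> nat \<Rightarrow> 'a \<Rightarrow> bool" where
  "miss i s \<omega> \<longleftrightarrow> mu i \<notin> eCI (\<lambda>t. W i t \<omega>) (exit_time (\<lambda>t. W i t \<omega>) (level s - 1))
     (\<delta> * real s / real CARD('k))"

definition chosen :: "'a \<Rightarrow> 'k set" where
  "chosen \<omega> = selected (\<lambda>i t. W i t \<omega>) \<gamma>"

definition FCP :: "'a \<Rightarrow> real" where
  "FCP \<omega> = fraction (chosen \<omega>) (\<lambda>i. miss i (card (chosen \<omega>)) \<omega>)"

text \<open>Agrees with \<open>FCP\<close> unless some path takes long to leave, and involves only
  hits, whose probabilities are controlled by \<open>prob_hits\<close>.\<close>

definition hit_fraction :: "'a \<Rightarrow> real" where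
  "hit_fraction \<omega> = fraction (hit_set (\<gamma> - 1) \<omega>)
     (\<lambda>i. hits (\<lambda>t. W i t \<omega>) (level (card (hit_set (\<gamma> - 1) \<omega>)) - 1))"

lemma eBY_FCR_eq: "eBY_FCR M W mu \<delta> \<gamma> = expectation FCP"
  unfolding eBY_FCR_def FCP_def[abs_def] fraction_def miss_def chosen_def level_def Let_def ..

lemma card_set_bounds:
  fixes A :: "'k set"
  shows "i \<in> A \<Longrightarrow> 0 < card A" "card A \<le> CARD('k)"
  by (auto simp: card_gt_0_iff intro: card_mono)

lemma inverse_level: "1 / (\<delta> * real s / real CARD('k)) = level s"
  by (simp add: level_def)

text \<open>The barrier depends on the random size of the selection; splitting over the finitely
  many possible sets \<open>A\<close> makes it fixed.\<close>

lemma measurable_FCP [measurable]: "FCP \<in> borel_measurable M"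
proof -
  have sel: "Measurable.pred M (\<lambda>\<omega>. i \<in> chosen \<omega>)" for i
    using pred_selected[of "W i" M "\<gamma> - 1"] W_cont W_zero gamma
    by (simp add: chosen_def selected_def)
  have "Measurable.pred M (\<lambda>\<omega>. \<forall>i\<in>UNIV. i \<in> chosen \<omega> \<longleftrightarrow> i \<in> A)" for A
  proof (intro pred_intros_finite)
    fix i
    show "Measurable.pred M (\<lambda>\<omega>. i \<in> chosen \<omega> \<longleftrightarrow> i \<in> A)"
      using sel[of i] by (cases "i \<in> A") (auto intro: pred_intros_logic)
  qed simp
  moreover have "(\<forall>i\<in>UNIV. i \<in> chosen \<omega> \<longleftrightarrow> i \<in> A) \<longleftrightarrow> chosen \<omega> = A" for \<omega> A by auto
  ultimately have [measurable]: "Measurable.pred M (\<lambda>\<omega>. chosen \<omega> = A)" for A by simp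
  have [measurable]: "(\<lambda>\<omega>. fraction A (\<lambda>i. miss i (card A) \<omega>)) \<in> borel_measurable M" for A
  proof -
    have "Measurable.pred M (\<lambda>\<omega>. miss i (card A) \<omega>)" if "i \<in> A" for i
      unfolding miss_def
      by (rule pred_eCI_miss)
        (use that W_cont W_zero mu_neg level_bounds card_set_bounds inverse_level in auto)
    then show ?thesis unfolding fraction_def
      by (intro borel_measurable_divide borel_measurable_sum borel_measurable_const measurable_If) auto
  qed
  have "FCP \<omega> = (\<Sum>A\<in>UNIV. if chosen \<omega> = A then fraction A (\<lambda>i. miss i (card A) \<omega>) else 0)" for \<omega>
    by (subst sum.delta') (auto simp: FCP_def)
  then have "FCP = (\<lambda>\<omega>. \<Sum>A\<in>UNIV. if chosen \<omega> = A then fraction A (\<lambda>i. miss i (card A) \<omega>) else 0)"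
    by (rule ext)
  moreover have "(\<lambda>\<omega>. \<Sum>A\<in>UNIV. if chosen \<omega> = A then fraction A (\<lambda>i. miss i (card A) \<omega>) else 0)
      \<in> borel_measurable M"
    by measurable
  ultimately show ?thesis by simp
qed

text \<open>The decoupling step: the barrier in each term is set by \<open>Suc (card A)\<close>,
  with \<open>A\<close> the selection among the others, and so does not involve path
  \<open>i\<close>. In the inner sum only \<open>A = S - {i}\<close> contributes.\<close>

lemma hit_fraction_eq:
  assumes \<omega>: "\<omega> \<in> space M"
  shows "hit_fraction \<omega> = (\<Sum>i\<in>UNIV. \<Sum>A\<in>Pow (UNIV - {i}).
    indicator (hit_event i (level (Suc (card A)) - 1) \<inter> others_event (\<gamma> - 1) i A) \<omega> / real (Suc (card A)))"
proof -
  define S where "S = hit_set (\<gamma> - 1) \<omega>"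
  have inner: "(\<Sum>A\<in>Pow (UNIV - {i}). indicator (hit_event i (level (Suc (card A)) - 1) \<inter> others_event (\<gamma> - 1) i A) \<omega> / real (Suc (card A)))
    = (if i \<in> S \<and> hits (\<lambda>t. W i t \<omega>) (level (card S) - 1) then 1 / real (card S) else 0)" for i
  proof -
    \<comment> \<open>The size of the selection once \<open>i\<close> is added, which is
      \<open>card S\<close> exactly when \<open>i \<in> S\<close>.\<close>
    define c where "c = Suc (card (S - {i}))"
    have "card (S - {i}) < CARD('k)" by (intro psubset_card_mono) auto
    then have c: "0 < c" "c \<le> CARD('k)" unfolding c_def by auto
    have "(\<Sum>A\<in>Pow (UNIV - {i}). indicator (hit_event i (level (Suc (card A)) - 1) \<inter> others_event (\<gamma> - 1) i A) \<omega> / real (Suc (card A)))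
      = (\<Sum>A\<in>Pow (UNIV - {i}). if A = S - {i} then (if hits (\<lambda>t. W i t \<omega>) (level c - 1) then 1 / real c else 0) else 0)"
      using \<omega> by (intro sum.cong) (auto simp: hit_event_def others_event_def S_def c_def indicator_def)
    also have "\<dots> = (if hits (\<lambda>t. W i t \<omega>) (level c - 1) then 1 / real c else 0)"
      by (subst sum.delta) auto
    also have "\<dots> = (if i \<in> S \<and> hits (\<lambda>t. W i t \<omega>) (level (card S) - 1) then 1 / real (card S) else 0)"
    proof (cases "i \<in> S")
      case True
      then have "c = card S" unfolding c_def using card_Suc_Diff1[of S i] by simp
      then show ?thesis using True by simp
    next
      case False
      \<comment> \<open>A hit of \<open>level c - 1\<close>, which is at least
        \<open>\<gamma> - 1\<close>, would put \<open>i\<close> in \<open>S\<close>; this is why the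
        terms carry no separate selection condition on \<open>i\<close>.\<close>
      then have "\<not> hits (\<lambda>t. W i t \<omega>) (level c - 1)"
        using hits_antimono[of _ "level c - 1" "\<gamma> - 1"] level_bounds(2)[OF c] by (auto simp: S_def hit_set_def)
      then show ?thesis using False by simp
    qed
    finally show ?thesis .
  qed
  have "(\<Sum>i\<in>UNIV. if i \<in> S \<and> hits (\<lambda>t. W i t \<omega>) (level (card S) - 1) then 1 / real (card S) else 0) =
    (\<Sum>i\<in>S. (if hits (\<lambda>t. W i t \<omega>) (level (card S) - 1) then 1 else 0) / real (max (card S) 1))"
  proof (rule sum.mono_neutral_cong_right)
    fix i assume "i \<in> S"
    then have "max (card S) 1 = card S" using card_set_bounds(1)[of i S] by simp
    then show "(if i \<in> S \<and> hits (\<lambda>t. W i t \<omega>) (level (card S) - 1) then 1 / real (card S) else 0) =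
      (if hits (\<lambda>t. W i t \<omega>) (level (card S) - 1) then 1 else 0) / real (max (card S) 1)"
      using \<open>i \<in> S\<close> by simp
  qed auto
  then show ?thesis
    unfolding inner by (simp add: hit_fraction_def fraction_def S_def sum_divide_distrib)
qed

lemma integrable_FCP: "integrable M FCP"
  by (intro integrable_const_bound[of _ 1] AE_I2)
    (simp_all add: FCP_def fraction_bounds)

lemma integrable_hit_indicator:
  assumes "A \<in> Pow (UNIV - {i})"
  shows "integrable M (\<lambda>\<omega>. indicator (hit_event i c \<inter> others_event a i A) \<omega> / (r::real))"
  using others_event_events[of A i a] assms by (auto simp: emeasure_eq_measure)

lemma integrable_hit_fraction: "integrable M hit_fraction"
proof -
  have "integrable M (\<lambda>\<omega>. \<Sum>i\<in>UNIV. \<Sum>A\<in>Pow (UNIV - {i}).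
    indicator (hit_event i (level (Suc (card A)) - 1) \<inter> others_event (\<gamma> - 1) i A) \<omega> / real (Suc (card A)))"
    by (intro Bochner_Integration.integrable_sum integrable_hit_indicator)
  moreover have "integrable M hit_fraction \<longleftrightarrow> integrable M (\<lambda>\<omega>. \<Sum>i\<in>UNIV. \<Sum>A\<in>Pow (UNIV - {i}).
    indicator (hit_event i (level (Suc (card A)) - 1) \<inter> others_event (\<gamma> - 1) i A) \<omega> / real (Suc (card A)))"
    by (rule Bochner_Integration.integrable_cong[OF refl hit_fraction_eq])
  ultimately show ?thesis by (rule iffD2[rotated])
qed

lemma expectation_hit_fraction:
  "expectation hit_fraction = (\<Sum>i\<in>UNIV. \<Sum>A\<in>Pow (UNIV - {i}).
    prob (others_event (\<gamma> - 1) i A) * (prob (hit_event i (level (Suc (card A)) - 1)) / real (Suc (card A))))"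
proof -
  have "expectation hit_fraction = expectation (\<lambda>\<omega>. \<Sum>i\<in>UNIV. \<Sum>A\<in>Pow (UNIV - {i}).
    indicator (hit_event i (level (Suc (card A)) - 1) \<inter> others_event (\<gamma> - 1) i A) \<omega> / real (Suc (card A)))"
    by (rule Bochner_Integration.integral_cong[OF refl hit_fraction_eq])
  also have "\<dots> = (\<Sum>i\<in>UNIV. expectation (\<lambda>\<omega>. \<Sum>A\<in>Pow (UNIV - {i}).
    indicator (hit_event i (level (Suc (card A)) - 1) \<inter> others_event (\<gamma> - 1) i A) \<omega> / real (Suc (card A))))"
    by (rule Bochner_Integration.integral_sum)
      (intro Bochner_Integration.integrable_sum integrable_hit_indicator)
  also have "\<dots> = (\<Sum>i\<in>UNIV. \<Sum>A\<in>Pow (UNIV - {i}). expectation (\<lambda>\<omega>.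
    indicator (hit_event i (level (Suc (card A)) - 1) \<inter> others_event (\<gamma> - 1) i A) \<omega> / real (Suc (card A))))"
    by (intro sum.cong refl Bochner_Integration.integral_sum integrable_hit_indicator)
  also have "\<dots> = (\<Sum>i\<in>UNIV. \<Sum>A\<in>Pow (UNIV - {i}).
    prob (others_event (\<gamma> - 1) i A) * (prob (hit_event i (level (Suc (card A)) - 1)) / real (Suc (card A))))"
  proof (intro sum.cong refl)
    fix i :: 'k and A assume A: "A \<in> Pow (UNIV - {i})"
    have "others_event (\<gamma> - 1) i A \<in> events" using others_event_events[of A i] A by simp
    then have ex: "expectation (\<lambda>\<omega>. indicator (hit_event i c \<inter> others_event (\<gamma> - 1) i A) \<omega> / r)
        = prob (hit_event i c \<inter> others_event (\<gamma> - 1) i A) / r" for c and r :: real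
      using sets.sets_into_space by (simp add: Int_absorb2 le_infI1)
    have "A \<subseteq> UNIV - {i}" using A by simp
    note ind = prob_hit_others(2)[OF this]
    show "expectation (\<lambda>\<omega>. indicator (hit_event i (level (Suc (card A)) - 1) \<inter> others_event (\<gamma> - 1) i A) \<omega> / real (Suc (card A)))
      = prob (others_event (\<gamma> - 1) i A) * (prob (hit_event i (level (Suc (card A)) - 1)) / real (Suc (card A)))"
      unfolding ex ind by simp
  qed
  finally show ?thesis .
qed

text \<open>Two errors add up: \<open>FCP\<close> against \<open>hit_fraction\<close>, bounded by
  the chance that some path is still inside at \<open>T i\<close>, and hitting probabilities against
  \<open>1 / level s\<close>. The times stay free, to be balanced later.\<close>

lemma FCR_bound:
  assumes T: "\<And>i. 0 < T i" "\<And>i. \<bar>mu i\<bar> * T i \<le> 1"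
  shows "\<bar>eBY_FCR M W mu \<delta> \<gamma> - \<delta>\<bar> \<le> (\<Sum>i\<in>UNIV. \<bar>mu i\<bar> * T i + 2 * level 1 / sqrt (T i))"
proof -
  have pos: "0 < level 1" using level_bounds(1)[of 1] by (simp add: Suc_leI)
  \<comment> \<open>Only the position at \<open>T i\<close> is inspected, with the largest barrier:
    this covers confinement at every lower level and has the Gaussian bound.\<close>
  define bad where "bad i = {\<omega>\<in>space M. -1 < W i (T i) \<omega> \<and> W i (T i) \<omega> < level 1 - 1}" for i
  have [measurable]: "bad i \<in> events" for i unfolding bad_def by measurable
  have good: "FCP \<omega> = hit_fraction \<omega>" if \<omega>: "\<omega> \<in> space M" "\<omega> \<notin> (\<Union>i. bad i)" for \<omega>
  proof -
    have nc: "\<not> confined (\<lambda>t. W i t \<omega>) a (T i)" if "a \<le> level 1 - 1" for i a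
    proof
      assume "confined (\<lambda>t. W i t \<omega>) a (T i)"
      from confined_mono_level[OF this that] have "\<omega> \<in> bad i"
        using \<omega>(1) T(1)[of i] by (simp add: confined_def bad_def)
      then show False using \<omega>(2) by blast
    qed
    have "\<gamma> \<le> level 1" using level_bounds(2)[of 1] by (simp add: Suc_leI)
    then have eq: "chosen \<omega> = hit_set (\<gamma> - 1) \<omega>"
      unfolding chosen_def hit_set_def selected_def
      using exit_time_props(5)[OF W_cont[OF \<omega>(1)] W_zero[OF \<omega>(1)] _ nc] gamma by auto
    have miss_iff: "miss i s \<omega> \<longleftrightarrow> hits (\<lambda>t. W i t \<omega>) (level s - 1)" if s: "0 < s" "s \<le> CARD('k)" for i s
    proof -
      have nc': "\<not> confined (\<lambda>t. W i t \<omega>) (level s - 1) (T i)"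
        using level_bounds(3)[OF s] by (intro nc) simp
      have "exit_time (\<lambda>t. W i t \<omega>) (level s - 1) \<le> T i"
        using level_bounds(1)[OF s] by (intro exit_time_props(2)[OF W_cont[OF \<omega>(1)] W_zero[OF \<omega>(1)] _ nc']) simp
      then have "- mu i * exit_time (\<lambda>t. W i t \<omega>) (level s - 1) \<le> - mu i * T i"
        using mu_neg[of i] by (intro mult_left_mono) auto
      \<comment> \<open>This excludes the miss by slow exit, since \<open>level s\<close> exceeds
        \<open>1\<close>.\<close>
      also have "\<dots> \<le> 1" using T(2)[of i] mu_neg[of i] by simp
      also have "\<dots> < level s" by (rule level_bounds(1)[OF s])
      finally show ?thesis
        unfolding miss_def
        using eCI_miss_iff[OF W_cont[OF \<omega>(1)] W_zero[OF \<omega>(1)] level_bounds(1)[OF s] mu_neg nc' inverse_level]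
        by auto
    qed
    show ?thesis
      unfolding FCP_def hit_fraction_def eq by (intro fraction_cong refl miss_iff card_set_bounds)
  qed
  have "\<bar>expectation FCP - expectation hit_fraction\<bar> = \<bar>expectation (\<lambda>\<omega>. FCP \<omega> - hit_fraction \<omega>)\<bar>"
    using integrable_FCP integrable_hit_fraction by simp
  also have "\<dots> \<le> expectation (\<lambda>\<omega>. \<bar>FCP \<omega> - hit_fraction \<omega>\<bar>)"
    by (rule integral_abs_bound)
  also have "\<dots> \<le> expectation (indicator (\<Union>i. bad i))"
  proof (rule integral_mono)
    fix \<omega> assume \<omega>: "\<omega> \<in> space M"
    show "\<bar>FCP \<omega> - hit_fraction \<omega>\<bar> \<le> indicator (\<Union>i. bad i) \<omega>"
    proof (cases "\<omega> \<in> (\<Union>i. bad i)")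
      case True
      have "0 \<le> FCP \<omega>" "FCP \<omega> \<le> 1" "0 \<le> hit_fraction \<omega>" "hit_fraction \<omega> \<le> 1"
        unfolding FCP_def hit_fraction_def by (rule fraction_bounds)+
      then show ?thesis using True by simp
    next
      case False
      then show ?thesis using good[OF \<omega>] by simp
    qed
  next
    show "integrable M (indicator (\<Union>i. bad i) :: _ \<Rightarrow> real)"
      by (auto simp: emeasure_eq_measure intro!: sets.finite_UN)
  qed (use integrable_FCP integrable_hit_fraction in simp)
  also have "\<dots> = prob (\<Union>i. bad i)"
    using sets.sets_into_space[of "\<Union>i. bad i" M] by (simp add: Int_absorb2 bad_def)
  also have "\<dots> \<le> (\<Sum>i\<in>UNIV. prob (bad i))"
    by (rule finite_measure_subadditive_finite) auto
  also have "\<dots> \<le> (\<Sum>i\<in>UNIV. level 1 / sqrt (T i))"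
  proof (rule sum_mono)
    fix i
    show "prob (bad i) \<le> level 1 / sqrt (T i)"
      using prob_W_between_le[OF T(1)[of i], of "level 1 - 1" i] level_bounds(1)[of 1]
      by (simp add: bad_def Suc_leI)
  qed
  finally have 1: "\<bar>expectation FCP - expectation hit_fraction\<bar> \<le> (\<Sum>i\<in>UNIV. level 1 / sqrt (T i))" .
  define e where "e i = \<bar>mu i\<bar> * T i + level 1 / sqrt (T i)" for i
  have e0: "0 \<le> e i" for i unfolding e_def using T(1)[of i] pos by simp
  define q where "q i A = prob (others_event (\<gamma> - 1) i A)" for i A
  define p where "p i A = prob (hit_event i (level (Suc (card A)) - 1)) / real (Suc (card A))" for i and A :: "'k set"
  have p: "\<bar>p i A - \<delta> / real CARD('k)\<bar> \<le> e i" if A: "A \<subseteq> UNIV - {i}" for i A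
  proof -
    define s where "s = Suc (card A)"
    have "card A < CARD('k)" using A by (intro psubset_card_mono) auto
    then have s: "0 < s" "s \<le> CARD('k)" unfolding s_def by auto
    have "\<bar>prob (hit_event i (level s - 1)) - 1 / level s\<bar> \<le> \<bar>mu i\<bar> * T i + level s / sqrt (T i)"
      using prob_hits[of "level s - 1" "T i" i] level_bounds(1)[OF s] T(1)[of i] by (simp add: hit_event_def)
    also have "\<dots> \<le> e i"
      unfolding e_def using level_bounds(3)[OF s] T(1)[of i] by (intro add_left_mono divide_right_mono) auto
    finally have le: "\<bar>prob (hit_event i (level s - 1)) - 1 / level s\<bar> \<le> e i" .
    \<comment> \<open>The product \<open>level s * s\<close> is \<open>CARD('k) / \<delta>\<close>
      for every \<open>s\<close>, so all sizes of the selection share the same limit.\<close>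
    have "p i A - \<delta> / real CARD('k) = (prob (hit_event i (level s - 1)) - 1 / level s) / real s"
      using s(1) delta by (simp add: p_def s_def[symmetric] level_def field_simps)
    then have "\<bar>p i A - \<delta> / real CARD('k)\<bar> = \<bar>prob (hit_event i (level s - 1)) - 1 / level s\<bar> / real s"
      by (simp add: abs_divide)
    also have "\<dots> \<le> e i / 1"
      using le s(1) e0[of i] by (intro frac_le) auto
    finally show ?thesis by simp
  qed
  have q: "(\<Sum>A\<in>Pow (UNIV - {i}). q i A) = 1" for i
    unfolding q_def by (rule sum_prob_others)
  \<comment> \<open>Each share \<open>\<delta> / CARD('k)\<close> is spread over the sets
    \<open>A\<close> with weights \<open>q i A\<close>, to match the expansion of the expectation
    term by term.\<close>
  have "\<delta> = (\<Sum>i\<in>(UNIV :: 'k set). \<delta> / real CARD('k))" by simp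
  also have "\<dots> = (\<Sum>i\<in>UNIV. \<Sum>A\<in>Pow (UNIV - {i}). q i A * (\<delta> / real CARD('k)))"
    unfolding sum_distrib_right[symmetric] q by simp
  finally have "expectation hit_fraction - \<delta> =
      (\<Sum>i\<in>UNIV. \<Sum>A\<in>Pow (UNIV - {i}). q i A * (p i A - \<delta> / real CARD('k)))"
    unfolding expectation_hit_fraction p_def[symmetric] q_def[symmetric]
    by (simp add: right_diff_distrib sum_subtractf)
  also have "\<bar>\<dots>\<bar> \<le> (\<Sum>i\<in>UNIV. \<Sum>A\<in>Pow (UNIV - {i}). \<bar>q i A * (p i A - \<delta> / real CARD('k))\<bar>)"
    by (intro order_trans[OF sum_abs] sum_mono sum_abs)
  also have "\<dots> \<le> (\<Sum>i\<in>UNIV. \<Sum>A\<in>Pow (UNIV - {i}). q i A * e i)"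
    using p by (intro sum_mono) (auto simp: abs_mult q_def intro!: mult_left_mono)
  also have "\<dots> = (\<Sum>i\<in>UNIV. e i)"
    unfolding sum_distrib_right[symmetric] q by simp
  finally have 2: "\<bar>expectation hit_fraction - \<delta>\<bar> \<le> (\<Sum>i\<in>UNIV. e i)" .
  have "\<bar>eBY_FCR M W mu \<delta> \<gamma> - \<delta>\<bar> \<le> (\<Sum>i\<in>UNIV. level 1 / sqrt (T i)) + (\<Sum>i\<in>UNIV. e i)"
    unfolding eBY_FCR_eq using 1 2 by linarith
  also have "\<dots> = (\<Sum>i\<in>UNIV. \<bar>mu i\<bar> * T i + 2 * level 1 / sqrt (T i))"
    unfolding e_def sum.distrib[symmetric] by (intro sum.cong) (auto simp: field_simps)
  finally show ?thesis .
qed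

end

text \<open>Spaces and processes may change with \<open>\<theta>\<close> without any coupling,
  because \<open>FCR_bound\<close> is an explicit bound at each single
  \<open>\<theta>\<close>.\<close>

theorem theorem3:
  fixes M :: "real ^ 'k \<Rightarrow> 'a measure"
    and W :: "real ^ 'k \<Rightarrow> 'k \<Rightarrow> real \<Rightarrow> 'a \<Rightarrow> real"
    and \<delta> \<gamma> :: real
  assumes "0 < \<delta>" "\<delta> < 1" "1 \<le> \<gamma>" "\<gamma> < 1 / \<delta>"
    and BM: "\<And>\<theta>. (\<forall>i. \<theta> $ i < 0) \<Longrightarrow> indep_BMs_drift (M \<theta>) (W \<theta>) (\<lambda>i. \<theta> $ i)"
  shows "((\<lambda>\<theta>. eBY_FCR (M \<theta>) (W \<theta>) (\<lambda>i. \<theta> $ i) \<delta> \<gamma>) \<longlongrightarrow> \<delta>)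
           (at 0 within {\<theta>. \<forall>i. \<theta> $ i < 0})"
proof -
  \<comment> \<open>The value of \<open>level 1\<close>, spelled out because \<open>level\<close>
    belongs to a locale interpreted separately for each \<open>\<theta>\<close>.\<close>
  define L where "L = real CARD('k) / \<delta>"
  define g where "g \<theta> = (\<Sum>i\<in>UNIV. sqrt \<bar>\<theta> $ i\<bar> + 2 * L * sqrt (sqrt \<bar>\<theta> $ i\<bar>))" for \<theta> :: "real ^ 'k"
  let ?F = "at 0 within {\<theta> :: real ^ 'k. \<forall>i. \<theta> $ i < 0}"
  have "\<forall>\<^sub>F \<theta> in ?F. norm (eBY_FCR (M \<theta>) (W \<theta>) (\<lambda>i. \<theta> $ i) \<delta> \<gamma> - \<delta>) \<le> g \<theta>"
    unfolding eventually_at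
  \<comment> \<open>Radius \<open>1\<close> gives \<open>\<bar>\<theta> $ i\<bar> \<le> 1\<close>,
    hence the hypothesis \<open>\<bar>\<theta> $ i\<bar> * T i \<le> 1\<close> of
    \<open>FCR_bound\<close>.\<close>
  proof (intro exI[of _ 1] conjI ballI impI)
    fix \<theta> :: "real ^ 'k"
    assume "\<theta> \<in> {\<theta>. \<forall>i. \<theta> $ i < 0}" and near: "\<theta> \<noteq> 0 \<and> dist \<theta> 0 < 1"
    then have neg: "\<theta> $ i < 0" for i by simp
    interpret eBY "M \<theta>" "W \<theta>" "\<lambda>i. \<theta> $ i" \<delta> \<gamma>
      using assms neg by unfold_locales auto
    \<comment> \<open>This grows as the drift vanishes, but slower than the inverse drift: both
      errors, \<open>sqrt \<bar>\<theta> $ i\<bar>\<close> and a multiple of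
      \<open>sqrt (sqrt \<bar>\<theta> $ i\<bar>)\<close>, tend to \<open>0\<close>.\<close>
    define T where "T i = 1 / sqrt \<bar>\<theta> $ i\<bar>" for i
    have sqrt_eq: "x * (1 / sqrt x) = sqrt x" if "0 < x" for x :: real
      using real_div_sqrt[of x] that by simp
    have T: "0 < T i" "\<bar>\<theta> $ i\<bar> * T i = sqrt \<bar>\<theta> $ i\<bar>" "1 / sqrt (T i) = sqrt (sqrt \<bar>\<theta> $ i\<bar>)" for i
    proof -
      show "\<bar>\<theta> $ i\<bar> * T i = sqrt \<bar>\<theta> $ i\<bar>"
        unfolding T_def using neg[of i] by (intro sqrt_eq) simp
    qed (use neg[of i] in \<open>auto simp: T_def real_sqrt_divide\<close>)
    have "\<bar>\<theta> $ i\<bar> \<le> 1" for i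
      using near component_le_norm_cart[of \<theta> i] by simp
    then have "\<bar>\<theta> $ i\<bar> * T i \<le> 1" for i unfolding T(2) by simp
    from FCR_bound[of T, OF T(1) this]
    have "\<bar>eBY_FCR (M \<theta>) (W \<theta>) (\<lambda>i. \<theta> $ i) \<delta> \<gamma> - \<delta>\<bar> \<le>
        (\<Sum>i\<in>UNIV. \<bar>\<theta> $ i\<bar> * T i + 2 * level 1 * (1 / sqrt (T i)))" by simp
    then show "norm (eBY_FCR (M \<theta>) (W \<theta>) (\<lambda>i. \<theta> $ i) \<delta> \<gamma> - \<delta>) \<le> g \<theta>"
      unfolding T(2,3) g_def L_def level_def by simp
  qed simp
  moreover have "(g \<longlongrightarrow> 0) ?F"
    unfolding g_def by (rule tendsto_eq_intros refl | simp)+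
  ultimately have "((\<lambda>\<theta>. eBY_FCR (M \<theta>) (W \<theta>) (\<lambda>i. \<theta> $ i) \<delta> \<gamma> - \<delta>) \<longlongrightarrow> 0) ?F"
    by (rule Lim_null_comparison)
  then show ?thesis by (rule LIM_zero_cancel)
qed

end
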